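(* For $L>0$ let $T_1(L)=2\pi e^{A_L}$. (1) If $T^\sharp>0$ satisfies $\beta^*:=\log\frac{T^\sharp}{2\pi}-\frac1{T^\sharp}-A_L>0$ (the condition required to apply the one-stroke reduction with frequency split $T^\sharp$), then $T^\sharp>T_1(L)$. (2) $A_L=(4+o(1))e^{L}$ as $L\to\infty$. Hence the size $N\asymp LT_1(L)$ of the matrix of a one-stroke certificate, and its number of quadrature nodes, grow doubly exponentially in $L$. (3) For every $L>0$, $\sup_{t\in\mathbb R}P_L(t)=A_L$. Consequently, within the class of certificates that bound the comb pointwise the threshold cannot be lowered: if $C$ is a constant with $P_L(t)\le C$ for all $t\in\mathbb R$, then $2\pi e^{C}\ge T_1(L)$.
   Context: $\Lambda$ is the von Mangoldt function. For $L>0$ the prime comb is $P_L(t)=\sum_{n\ge2,\ \log n<2L}\frac{2\Lambda(n)}{\sqrt n}\cos(t\log n)$ and its mass is $A_L=\sum_{n\ge2,\ \log n<2L}\frac{2\Lambda(n)}{\sqrt n}$. One-stroke certificate: the Weil quadratic form on real even functions supported in $[-L,L]$ is $Q(f)=2\hat f(i/2)^2+\frac1{2\pi}\int_{\mathbb R}|\hat f(t)|^2\Psi_L(t)\,dt$ with $\hat f(z)=\int f(u)e^{izu}du$, $\Psi_L(t)=\operatorname{Re}\frac{\Gamma'}{\Gamma}(\frac14+\frac{it}2)-\log\pi-P_L(t)$. One picks $T^\sharp$ with $\beta^*=\log\frac{T^\sharp}{2\pi}-\frac1{T^\sharp}-A_L>0$, bounds $Q$ below by the form $R(f)=2\hat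 f(i/2)^2+\frac1\pi\int_0^{T^\sharp}(\Psi_L-\beta^* )|\hat f|^2\,dt+\beta^*\|f\|_2^2$, and certifies positivity of the leading $N\times N$ block of the matrix of $R$ in the basis of $L^2$-normalized even-order Legendre functions on $[-L,L]$, where the first discarded order $2N$ must be at least of size $eLT^\sharp/2$ (so $N\asymp LT^\sharp$, with $T^\sharp$ taken of order $T_1$). The matrix entries are integrals over $[0,T^\sharp]$, computed by Gauss quadrature with a fixed number of nodes on panels of fixed width, so the number of nodes is proportional to $T^\sharp$. *)

theory Defs
  imports
    "HOL-Analysis.Analysis"
    "HOL-Number_Theory.Prime_Powers"
    "HOL-Library.Landau_Symbols"
    "HOL-Computational_Algebra.Polynomial"
    "Jordan_Normal_Form.Matrix"
begin

definition prime_comb :: "real \<Rightarrow> real \<Rightarrow> real" where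
  "prime_comb L t =
     (\<Sum>n | 2 \<le> n \<and> ln (real n) < 2 * L.
        2 * mangoldt n / sqrt (real n) * cos (t * ln (real n)))"

definition comb_mass :: "real \<Rightarrow> real" where
  "comb_mass L =
     (\<Sum>n | 2 \<le> n \<and> ln (real n) < 2 * L. 2 * mangoldt n / sqrt (real n))"

definition T1 :: "real \<Rightarrow> real" where
  "T1 L = 2 * pi * exp (comb_mass L)"

text \<open>The margin \<open>\<beta>\<^sup>*\<close> of the frequency split \<open>T\<close>; it is only meaningful for \<open>T > 0\<close>.\<close>

definition beta_star :: "real \<Rightarrow> real \<Rightarrow> real" where
  "beta_star L T = ln (T / (2 * pi)) - 1 / T - comb_mass L"

definition Psi :: "real \<Rightarrow> real \<Rightarrow> real" where
  "Psi L t = Re (Digamma (1 / 4 + \<i> * of_real t / 2)) - ln pi - prime_comb L t"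

definition fourier_hat :: "(real \<Rightarrow> real) \<Rightarrow> complex \<Rightarrow> complex" where
  "fourier_hat f z = (LINT u|lborel. of_real (f u) * exp (\<i> * of_real u * z))"

text \<open>The lower bound \<open>R\<close> for the Weil form, for real even \<open>f\<close> supported in \<open>[-L,L]\<close>. The
  value of the transform at \<open>\<i>/2\<close> is real, so taking its real part loses nothing.\<close>

definition one_stroke_form :: "real \<Rightarrow> real \<Rightarrow> (real \<Rightarrow> real) \<Rightarrow> real" where
  "one_stroke_form L T f =
     2 * (Re (fourier_hat f (\<i> / 2)))\<^sup>2
     + 1 / pi * (LINT t:{0..T}|lborel.
         (Psi L t - beta_star L T) * (cmod (fourier_hat f (of_real t)))\<^sup>2)
     + beta_star L T * (LINT u|lborel. (f u)\<^sup>2)"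

text \<open>Legendre polynomials, by the formula of Rodrigues.\<close>

definition legendre_poly :: "nat \<Rightarrow> real poly" where
  "legendre_poly n = Polynomial.smult (1 / (2 ^ n * fact n)) ((pderiv ^^ n) ([:-1, 0, 1:] ^ n))"

text \<open>The factor normalizes in \<open>L\<^sup>2[-L,L]\<close>, since \<open>P\<^sub>n\<close> has square integral \<open>2/(2n+1)\<close> on \<open>[-1,1]\<close>.\<close>

definition legendre_fun :: "real \<Rightarrow> nat \<Rightarrow> real \<Rightarrow> real" where
  "legendre_fun L n u =
     (if \<bar>u\<bar> \<le> L then sqrt ((2 * real n + 1) / (2 * L)) * poly (legendre_poly n) (u / L) else 0)"

text \<open>The leading \<open>N \<times> N\<close> block of the matrix of the quadratic form \<open>R\<close>, with entries given by
  polarization. The retained orders are \<open>0, 2, \<dots>, 2N - 2\<close>, so the first discarded one is \<open>2N\<close>.\<close>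

definition one_stroke_matrix :: "real \<Rightarrow> real \<Rightarrow> nat \<Rightarrow> real mat" where
  "one_stroke_matrix L T N = Matrix.mat N N (\<lambda>(j, k).
     (one_stroke_form L T (\<lambda>u. legendre_fun L (2 * j) u + legendre_fun L (2 * k) u)
      - one_stroke_form L T (\<lambda>u. legendre_fun L (2 * j) u - legendre_fun L (2 * k) u)) / 4)"

text \<open>The requirements on the parameters of a certificate. Positivity of the block is deliberately
  not among them: it is the outcome of the computation, whose cost is what is estimated.\<close>

definition one_stroke_admissible :: "real \<Rightarrow> real \<Rightarrow> nat \<Rightarrow> bool" where
  "one_stroke_admissible L T N \<longleftrightarrow>
     T > 0 \<and> beta_star L T > 0 \<and> real (2 * N) \<ge> exp 1 * L * T / 2"

text \<open>Gauss nodes of order \<open>q\<close> on each panel of a partition of \<open>[0,T]\<close> into panels of width \<open>w\<close>,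
  the last one truncated at \<open>T\<close>. The Gauss nodes on \<open>[-1,1]\<close> are the roots of \<open>P\<^sub>q\<close>.\<close>

definition panel_end :: "real \<Rightarrow> real \<Rightarrow> nat \<Rightarrow> real" where
  "panel_end w T k = min T (w * real k)"

definition quadrature_nodes :: "nat \<Rightarrow> real \<Rightarrow> real \<Rightarrow> real set" where
  "quadrature_nodes q w T =
     (\<Union>k<nat \<lceil>T / w\<rceil>.
        (\<lambda>x. panel_end w T k + (panel_end w T (Suc k) - panel_end w T k) * (1 + x) / 2)
          ` {x. poly (legendre_poly q) x = 0})"

definition grows_doubly_exponentially :: "(real \<Rightarrow> real) \<Rightarrow> bool" where
  "grows_doubly_exponentially f \<longleftrightarrow>
     (\<exists>a b c d. a > 0 \<and> b > 0 \<and> c > 0 \<and> d > 0 \<and>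
       (\<forall>\<^sub>F x in at_top. exp (a * exp (b * x)) \<le> f x \<and> f x \<le> exp (c * exp (d * x))))"

end

theory Submission
  imports
    Defs
    "HOL-Complex_Analysis.Complex_Analysis"
    "HOL-Real_Asymp.Real_Asymp"
begin

text \<open>
  The heart of the matter is the asymptotic formula \<open>A\<^sub>L \<sim> 4 e\<^sup>L\<close>, which is a form of the prime
  number theorem. Write \<open>\<psi>(n)\<close> for the sum of the von Mangoldt function up to \<open>n\<close>. If
  \<open>\<psi>(n) \<sim> n\<close>, then by partial summation the sum of \<open>\<Lambda>(n) / \<surd>n\<close> over \<open>n \<le> N\<close> is asymptotic to
  \<open>2 \<surd>N\<close>. The mass \<open>A\<^sub>L\<close> is twice this sum for the largest \<open>N\<close> below \<open>e\<^bsup>2L\<^esup>\<close>, so that \<open>\<surd>N \<sim> e\<^sup>L\<close>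
  (\<open>comb_mass_asymptotics\<close>).

  The prime number theorem is proved by Newman's method. Let \<open>Z(s) = (s - 1) \<zeta>(s)\<close>, which is
  holomorphic on \<open>Re s > 0\<close> and has \<open>Z(1) = 1\<close>, and let \<open>D(s)\<close> be the Dirichlet series of \<open>\<Lambda>\<close>,
  so that \<open>D(s) = 1 / (s - 1) - Z'(s) / Z(s)\<close>. Partial summation shows that, for \<open>Re s > 1\<close>, the
  integral of \<open>(\<psi>(x) - x) x\<^bsup>-s-1\<^esup>\<close> over \<open>[1, \<infinity>)\<close> is
  \<open>D(s) / s - 1 / (s - 1) = - (1 + Z'(s) / Z(s)) / s\<close>. Since \<open>Z\<close> has no zero with \<open>Re s \<ge> 1\<close>
  (\<open>zeta_pole_free_nonzero\<close>, from \<open>3 + 4 cos \<theta> + cos 2\<theta> \<ge> 0\<close>), the right-hand side is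
  holomorphic on a neighbourhood of that half-plane. As \<open>\<psi>(x) - x = O(x)\<close> by Chebyshev's bound
  (\<open>chebyshev_psi_le\<close>), the Tauberian theorem \<open>newman_tauberian\<close> yields convergence of the
  integral at \<open>s = 1\<close>. Because \<open>\<psi>\<close> is monotone, \<open>\<psi>(n) \<ge> l n\<close> with \<open>l > 1\<close>, or \<open>\<psi>(n) \<le> l n\<close> with
  \<open>l < 1\<close>, would force a contribution bounded away from \<open>0\<close> over an interval of length
  proportional to \<open>n\<close>; convergence excludes this for large \<open>n\<close>.

  The other claims are elementary. A positive margin says \<open>ln (T / 2\<pi>) > A\<^sub>L\<close>. At \<open>t = 0\<close> all
  cosines are \<open>1\<close>, so the comb attains its mass. The matrix size lies between multiples of
  \<open>L T\<close>, and \<open>T\<close> is of the order of \<open>T\<^sub>1(L)\<close>. Each of the \<open>\<lceil>T / w\<rceil>\<close> panels has boundedly many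
  nodes, and one of them is interior because a Legendre polynomial of positive degree has a root
  in \<open>(-1, 1)\<close>, so the number of nodes lies between multiples of \<open>T\<close> as well. Both quantities
  are doubly exponential since \<open>T\<^sub>1(L) = 2\<pi> exp A\<^sub>L\<close> with \<open>3 e\<^sup>L \<le> A\<^sub>L \<le> 5 e\<^sup>L\<close> for large \<open>L\<close>.
\<close>

section \<open>Chebyshev's upper bound\<close>

definition chebyshev_psi :: "nat \<Rightarrow> real" where
  "chebyshev_psi n = (\<Sum>k=1..n. mangoldt k)"

lemma chebyshev_psi_mono: "m \<le> n \<Longrightarrow> chebyshev_psi m \<le> chebyshev_psi n"
  unfolding chebyshev_psi_def by (intro sum_mono2) (auto simp: mangoldt_nonneg)

lemma chebyshev_psi_nonneg: "0 \<le> chebyshev_psi n"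
  unfolding chebyshev_psi_def by (intro sum_nonneg) (auto simp: mangoldt_nonneg)

text \<open>The logarithm of \<open>m\<close> is the sum of \<open>\<Lambda>(d)\<close> over the divisors of \<open>m\<close>, and \<open>n div d\<close>
  counts the multiples of \<open>d\<close> up to \<open>n\<close>.\<close>

lemma ln_fact_eq_sum_mangoldt:
  "ln (fact n :: real) = (\<Sum>d=1..n. mangoldt d * real (n div d))"
proof (induction n)
  case (Suc n)
  have "ln (real (Suc n)) = (\<Sum>d | d dvd Suc n. mangoldt d :: real)"
    using mangoldt_sum[of "Suc n", where ?'a = real] by simp
  also have "{d. d dvd Suc n} = {d\<in>{1..Suc n}. d dvd Suc n}"
    by (auto dest: dvd_imp_le simp: Suc_le_eq intro!: Nat.gr0I)
  also have "(\<Sum>d\<in>\<dots>. mangoldt d :: real)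
      = (\<Sum>d=1..Suc n. if d dvd Suc n then mangoldt d else 0)"
    by (rule sum.inter_filter) auto
  finally have ln_Suc: "ln (real (Suc n))
      = (\<Sum>d=1..Suc n. if d dvd Suc n then mangoldt d else 0)" .
  have "ln (fact (Suc n) :: real) = ln (real (Suc n)) + ln (fact n)"
    by (simp add: ln_mult)
  also have "ln (fact n :: real) = (\<Sum>d=1..Suc n. mangoldt d * real (n div d))"
    using Suc by simp
  also have "ln (real (Suc n)) + \<dots> =
      (\<Sum>d=1..Suc n. mangoldt d * real (Suc n div d))"
    unfolding ln_Suc sum.distrib [symmetric]
    by (intro sum.cong) (auto simp: div_Suc algebra_simps dvd_eq_mod_eq_0)
  finally show ?case .
qed auto

text \<open>The binomial coefficient of \<open>2n\<close> over \<open>n\<close> is at most \<open>4\<^sup>n\<close>. Its logarithm is the sum of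
  \<open>\<Lambda>(d) (\<lfloor>2n/d\<rfloor> - 2\<lfloor>n/d\<rfloor>)\<close>, in which no term is negative and every \<open>d\<close> with \<open>n < d \<le> 2n\<close> has
  coefficient \<open>1\<close>.\<close>

lemma chebyshev_psi_double:
  "chebyshev_psi (2 * n) \<le> chebyshev_psi n + real n * ln 4"
proof -
  define b :: real where "b = real ((2 * n) choose n)"
  have b: "b = fact (2 * n) / (fact n * fact n)"
    by (simp add: b_def binomial_fact)
  have ln_b: "ln b = ln (fact (2 * n)) - 2 * ln (fact n :: real)"
    by (simp add: b ln_div ln_mult)
  have ext: "(\<Sum>d=1..n. mangoldt d * real (n div d)) =
      (\<Sum>d=1..2*n. mangoldt d * real (n div d))"
    by (rule sum.mono_neutral_left) auto
  have "chebyshev_psi (2 * n) - chebyshev_psi n = (\<Sum>d\<in>{1..2*n} - {1..n}. mangoldt d)"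
    unfolding chebyshev_psi_def by (subst sum_diff) auto
  also have "\<dots> \<le> (\<Sum>d=1..2*n. mangoldt d * (real (2 * n div d) - 2 * real (n div d)))"
  proof -
    have ge0: "2 * (n div d) \<le> 2 * n div d" for d
      by (cases "d = 0") (auto simp: less_eq_div_iff_mult_less_eq algebra_simps)
    have ge1: "2 * n div d - 2 * (n div d) \<ge> 1" if "d \<in> {1..2*n} - {1..n}" for d
      using that by (auto simp: Suc_le_eq div_greater_zero_iff)
    show ?thesis
    proof (rule sum_le_included[where i = id], goal_cases)
      case 3
      show ?case
      proof
        fix d assume "d \<in> {1..2 * n}"
        show "0 \<le> mangoldt d * (real (2 * n div d) - 2 * real (n div d))"
          using ge0[of d] by (intro mult_nonneg_nonneg mangoldt_nonneg) linarith
      qed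
    next
      case 4
      show ?case
      proof
        fix d assume d: "d \<in> {1..2*n} - {1..n}"
        have "mangoldt d * 1 \<le> mangoldt d * (real (2 * n div d) - 2 * real (n div d))"
          using ge1[OF d] by (intro mult_left_mono mangoldt_nonneg) linarith
        thus "\<exists>x\<in>{1..2*n}. id x = d \<and>
            mangoldt d \<le> mangoldt x * (real (2 * n div x) - 2 * real (n div x))"
          using d by auto
      qed
    qed auto
  qed
  also have "\<dots> = ln b"
    unfolding ln_b ln_fact_eq_sum_mangoldt ext
    by (simp add: algebra_simps sum_subtractf sum_distrib_left)
  also have "\<dots> \<le> ln (4 ^ n)"
  proof -
    have "(2 * n) choose n \<le> 4 ^ n"
      using binomial_le_pow2[of "2 * n" n] by (simp add: power_mult)
    hence "b \<le> 4 ^ n"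
      unfolding b_def by (metis of_nat_le_iff of_nat_numeral of_nat_power)
    moreover have "b > 0" by (simp add: b)
    ultimately show ?thesis by simp
  qed
  finally show ?thesis by (simp add: ln_realpow)
qed

text \<open>Repeated halving. The constant \<open>6\<close> leaves room for rounding an odd argument up to the
  next even one.\<close>

theorem chebyshev_psi_le: "chebyshev_psi n \<le> 6 * real n"
proof (induction n rule: less_induct)
  case (less n)
  have ln4: "ln 4 \<le> (3 :: real)"
    using ln_le_minus_one[of "4 :: real"] by simp
  consider "n = 0" | "n = 1" | m where "n = 2 * m" "m \<ge> 1" | m where "n = 2 * m + 1" "m \<ge> 1"
    by (cases "even n") (auto elim!: evenE oddE, force+)
  thus ?case
  proof cases
    case (3 m)
    have "chebyshev_psi n \<le> 6 * real m + real m * ln 4"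
      using chebyshev_psi_double[of m] less[of m] 3 by simp
    also have "\<dots> \<le> 6 * real m + real m * 3" using ln4 by (intro add_mono mult_left_mono) auto
    finally show ?thesis using 3 by simp
  next
    case (4 m)
    have "chebyshev_psi n \<le> chebyshev_psi (2 * Suc m)"
      using 4 by (intro chebyshev_psi_mono) auto
    also have "\<dots> \<le> 6 * real (Suc m) + real (Suc m) * ln 4"
      using chebyshev_psi_double[of "Suc m"] less[of "Suc m"] 4 by simp
    also have "\<dots> \<le> 6 * real (Suc m) + real (Suc m) * 3"
      using ln4 by (intro add_mono mult_left_mono) auto
    finally show ?thesis using 4 by simp
  qed (auto simp: chebyshev_psi_def)
qed

section \<open>Newman's Tauberian theorem\<close>

definition right_arc :: "real \<Rightarrow> real \<Rightarrow> complex" where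
  "right_arc R = part_circlepath 0 R (- (pi / 2)) (pi / 2)"

definition left_arc :: "real \<Rightarrow> real \<Rightarrow> complex" where
  "left_arc R = part_circlepath 0 R (pi / 2) (3 * pi / 2)"

lemma exp_i_half_pi [simp]:
  "exp (\<i> * complex_of_real (pi / 2)) = \<i>" "exp (\<i> * complex_of_real (- (pi / 2))) = - \<i>"
  "exp (\<i> * complex_of_real (3 * pi / 2)) = - \<i>"
proof -
  have *: "exp (\<i> * complex_of_real x) = cis x" for x by (simp add: cis_conv_exp)
  show "exp (\<i> * complex_of_real (pi / 2)) = \<i>" unfolding * by simp
  show "exp (\<i> * complex_of_real (- (pi / 2))) = - \<i>"
    unfolding * by (simp add: complex_eq_iff)
  show "exp (\<i> * complex_of_real (3 * pi / 2)) = - \<i>"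
    unfolding * using cos_3over2_pi sin_3over2_pi by (simp add: complex_eq_iff mult.commute)
qed

lemma arc_endpoints [simp]:
  "pathstart (right_arc R) = - (\<i> * of_real R)" "pathfinish (right_arc R) = \<i> * of_real R"
  "pathstart (left_arc R) = \<i> * of_real R" "pathfinish (left_arc R) = - (\<i> * of_real R)"
  by (simp_all add: right_arc_def left_arc_def del: of_real_divide of_real_mult of_real_minus)

lemma valid_path_arc [simp]: "valid_path (right_arc R)" "valid_path (left_arc R)"
  by (simp_all add: right_arc_def left_arc_def)

lemma right_arc_image:
  assumes "R > 0" "z \<in> path_image (right_arc R)"
  shows "norm z = R" "Re z \<ge> 0"
proof -
  obtain x where x: "- (pi / 2) \<le> x" "x \<le> pi / 2" and z: "z = of_real R * cis x"
    using assms by (auto simp: right_arc_def path_image_part_circlepath' closed_segment_eq_real_ivl)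
  show "norm z = R" using assms by (simp add: z norm_mult)
  show "Re z \<ge> 0" using assms x by (auto simp: z cos_ge_zero)
qed

lemma left_arc_image:
  assumes "R > 0" "z \<in> path_image (left_arc R)"
  shows "norm z = R" "Re z \<le> 0"
proof -
  obtain x where x: "pi / 2 \<le> x" "x \<le> 3 * pi / 2" and z: "z = of_real R * cis x"
    using assms by (auto simp: left_arc_def path_image_part_circlepath' closed_segment_eq_real_ivl)
  show "norm z = R" using assms by (simp add: z norm_mult)
  have "cos (x - pi) \<ge> 0" using x by (intro cos_ge_zero) auto
  thus "Re z \<le> 0" using assms by (auto simp: z mult_nonneg_nonpos)
qed

text \<open>Cauchy's formula for a loop that closes the right half circle by a path \<open>g\<close> on its
  left. The winding number is found with the primitive \<open>Ln z\<close> of \<open>1 / z\<close> on the right and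
  \<open>Ln (- z)\<close> on the left, each of which grows by \<open>\<i> \<pi>\<close>. As \<open>g\<close> is only required to avoid the
  nonnegative real axis, it may be the left half circle as well as a path that stays close to
  the imaginary axis.\<close>

lemma half_circle_loop_formula:
  assumes R: "R > 0" and g: "valid_path g" "pathstart g = \<i> * of_real R" "pathfinish g = - (\<i> * of_real R)"
    and slit: "path_image g \<inter> \<real>\<^sub>\<ge>\<^sub>0 = {}"
    and V: "convex V" "open V" "path_image g \<subseteq> V" "path_image (right_arc R) \<subseteq> V" "0 \<in> V"
    and G: "G holomorphic_on V"
  shows "contour_integral (right_arc R) (\<lambda>z. G z / z) + contour_integral g (\<lambda>z. G z / z)
           = 2 * pi * \<i> * G 0"
proof -
  let ?l = "right_arc R +++ g"
  have z0: "0 \<notin> path_image (right_arc R)" "0 \<notin> path_image g"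
    using right_arc_image[OF R, of 0] R slit by auto
  have Ln_right: "((\<lambda>z. 1 / z) has_contour_integral (Ln (\<i> * of_real R) - Ln (- (\<i> * of_real R))))
      (right_arc R)"
  proof -
    have "((\<lambda>z. 1 / z) has_contour_integral
        (Ln (pathfinish (right_arc R)) - Ln (pathstart (right_arc R)))) (right_arc R)"
    proof (rule contour_integral_primitive[where S = "- \<real>\<^sub>\<le>\<^sub>0"])
      fix z assume "z \<in> - (\<real>\<^sub>\<le>\<^sub>0 :: complex set)"
      thus "(Ln has_field_derivative 1 / z) (at z within - \<real>\<^sub>\<le>\<^sub>0)"
        by (auto intro!: derivative_eq_intros simp: field_simps)
    next
      show "path_image (right_arc R) \<subseteq> - \<real>\<^sub>\<le>\<^sub>0"
        using right_arc_image[OF R] R z0(1)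
        by (force simp: complex_nonpos_Reals_iff complex_eq_iff)
    qed simp
    thus ?thesis by simp
  qed
  have Ln_left: "((\<lambda>z. 1 / z) has_contour_integral (Ln (\<i> * of_real R) - Ln (- (\<i> * of_real R)))) g"
  proof -
    have "((\<lambda>z. 1 / z) has_contour_integral
        (Ln (- pathfinish g) - Ln (- pathstart g))) g"
    proof (rule contour_integral_primitive[where S = "- \<real>\<^sub>\<ge>\<^sub>0"])
      fix z assume z: "z \<in> - (\<real>\<^sub>\<ge>\<^sub>0 :: complex set)"
      hence "- z \<notin> \<real>\<^sub>\<le>\<^sub>0" by (auto simp: complex_nonpos_Reals_iff complex_nonneg_Reals_iff)
      thus "((\<lambda>z. Ln (- z)) has_field_derivative 1 / z) (at z within - \<real>\<^sub>\<ge>\<^sub>0)"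
        using z by (auto intro!: derivative_eq_intros simp: field_simps)
    qed (use g slit in auto)
    thus ?thesis using g by simp
  qed
  have Ln_i: "Ln (\<i> * of_real R) - Ln (- (\<i> * of_real R)) = \<i> * pi"
  proof -
    have "Ln (\<i> * of_real R) = ln R + \<i> * pi / 2"
      using Ln_times_of_real[of R \<i>] R by (simp add: mult.commute Ln_of_real)
    moreover have "Ln (- (\<i> * of_real R)) = ln R - \<i> * pi / 2"
      using Ln_times_of_real[of R "-\<i>"] R by (simp add: mult.commute Ln_of_real)
    ultimately show ?thesis by simp
  qed
  have wind: "winding_number ?l 0 = 1"
  proof -
    have "((\<lambda>z. 1 / z) has_contour_integral (\<i> * pi + \<i> * pi)) ?l"
      using has_contour_integral_join[OF Ln_right Ln_left] g by (simp add: Ln_i)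
    hence "contour_integral ?l (\<lambda>w. 1 / (w - 0)) = 2 * pi * \<i>"
      by (simp add: contour_integral_unique)
    moreover have "valid_path ?l" "0 \<notin> path_image ?l"
      using g z0 by (auto simp: path_image_join)
    ultimately show ?thesis by (simp add: winding_number_valid_path)
  qed
  have "((\<lambda>w. G w / (w - 0)) has_contour_integral (2 * pi * \<i> * winding_number ?l 0 * G 0)) ?l"
    using V g z0
    by (intro Cauchy_integral_formula_convex_simple[OF V(1) G]) (auto simp: path_image_join interior_open)
  hence "contour_integral ?l (\<lambda>z. G z / z) = 2 * pi * \<i> * G 0"
    using wind by (simp add: contour_integral_unique)
  moreover have "(\<lambda>z. G z / z) contour_integrable_on h"
    if "valid_path h" "path_image h \<subseteq> V" "0 \<notin> path_image h" for h
    using that V by (intro contour_integrable_holomorphic_simple[where S = "V - {0}"])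
      (auto intro!: holomorphic_intros holomorphic_on_subset[OF G])
  ultimately show ?thesis using g V z0 by simp
qed

text \<open>On the circle, \<open>1 / z = cnj z / R\<^sup>2\<close>, so Newman's kernel \<open>1 / z + z / R\<^sup>2\<close> is
  \<open>2 Re z / R\<^sup>2\<close>. Its zeros at \<open>\<plusminus> \<i> R\<close> are what the factor \<open>1 + z\<^sup>2 / R\<^sup>2\<close> is inserted for.\<close>

lemma newman_kernel_on_circle:
  assumes "norm z = R" "R > 0"
  shows "norm ((1 + z\<^sup>2 / of_real (R\<^sup>2)) / z) = 2 * \<bar>Re z\<bar> / R\<^sup>2"
proof -
  have "z \<noteq> 0" using assms by auto
  have "z * cnj z = of_real (R\<^sup>2)"
    using assms by (simp add: complex_norm_square [symmetric])
  hence "(1 + z\<^sup>2 / of_real (R\<^sup>2)) / z = (cnj z + z) / of_real (R\<^sup>2)"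
    using \<open>z \<noteq> 0\<close> assms by (simp add: field_simps power2_eq_square)
  also have "cnj z + z = of_real (2 * Re z)"
    by (simp add: complex_eq_iff)
  finally show ?thesis
    using assms by (simp only: norm_divide norm_of_real) (simp add: abs_mult)
qed

lemma norm_exp_times_ln: "P > 0 \<Longrightarrow> norm (exp (z * of_real (ln P))) = P powr Re z"
  by (simp add: powr_def)

text \<open>The kernel compensates both the growth of \<open>P\<^sup>z\<close> against \<open>P\<^bsup>-Re z\<^esup>\<close> and the factor
  \<open>1 / \<bar>Re z\<bar>\<close>, so the bound is uniform in \<open>P\<close> and along the whole arc.\<close>

lemma newman_arc_bound:
  assumes R: "R > 0" and P: "P > 0" and C: "C \<ge> 0" and z: "norm z = R"
    and H: "Re z \<noteq> 0 \<Longrightarrow> norm h \<le> C * P powr (- Re z) / \<bar>Re z\<bar>"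
  shows "norm (h * exp (z * of_real (ln P)) * (1 + z\<^sup>2 / of_real (R\<^sup>2)) / z) \<le> 2 * C / R\<^sup>2"
proof (cases "Re z = 0")
  case True
  thus ?thesis
    using newman_kernel_on_circle[OF z R] C by (auto simp: norm_mult norm_divide)
next
  case False
  have "norm (h * exp (z * of_real (ln P)) * (1 + z\<^sup>2 / of_real (R\<^sup>2)) / z) =
      norm h * norm (exp (z * of_real (ln P))) * norm ((1 + z\<^sup>2 / of_real (R\<^sup>2)) / z)"
    by (simp only: norm_mult norm_divide times_divide_eq_right)
  also have "\<dots> = norm h * P powr Re z * (2 * \<bar>Re z\<bar> / R\<^sup>2)"
    by (simp only: newman_kernel_on_circle[OF z R] norm_exp_times_ln[OF P])
  finally have "norm (h * exp (z * of_real (ln P)) * (1 + z\<^sup>2 / of_real (R\<^sup>2)) / z) =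
      norm h * P powr Re z * (2 * \<bar>Re z\<bar> / R\<^sup>2)" .
  also have "norm h * P powr Re z * (2 * \<bar>Re z\<bar> / R\<^sup>2)
      \<le> C * P powr (- Re z) / \<bar>Re z\<bar> * P powr Re z * (2 * \<bar>Re z\<bar> / R\<^sup>2)"
    using H[OF False] by (intro mult_right_mono) auto
  also have "\<dots> = 2 * C / R\<^sup>2"
    using False P by (simp add: powr_minus field_simps)
  finally show ?thesis .
qed


text \<open>The integral of the limit function cannot follow the left half circle, because that
  function need only be holomorphic near the closed right half-plane; it follows three sides of
  a thin rectangle instead.\<close>

definition left_detour :: "real \<Rightarrow> real \<Rightarrow> real \<Rightarrow> complex" where
  "left_detour R d = linepath (Complex 0 R) (Complex (- d) R)
     +++ linepath (Complex (- d) R) (Complex (- d) (- R)) +++ linepath (Complex (- d) (- R)) (Complex 0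
         (- R))"

lemma left_detour_path [simp]:
  "valid_path (left_detour R d)" "pathstart (left_detour R d) = \<i> * of_real R"
  "pathfinish (left_detour R d) = - (\<i> * of_real R)"
  by (auto simp: left_detour_def complex_eq_iff)

lemma closed_segment_complex:
  assumes "z \<in> closed_segment a b"
  shows "Re z \<in> closed_segment (Re a) (Re b) \<and> Im z \<in> closed_segment (Im a) (Im b)"
  using assms by (auto simp: closed_segment_def)

lemma left_detour_image:
  assumes "R > 0" "d > 0" "z \<in> path_image (left_detour R d)"
  shows "- d \<le> Re z" "Re z \<le> 0" "\<bar>Im z\<bar> \<le> R" "Re z = - d \<or> \<bar>Im z\<bar> = R"
  using assms
  by (auto simp: left_detour_def path_image_join closed_segment_eq_real_ivl
      dest!: closed_segment_complex split: if_splits)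

text \<open>The first term comes from the horizontal sides, which are short; the second comes from
  the vertical side, where \<open>P\<^sup>z\<close> has modulus \<open>P\<^bsup>-d\<^esup>\<close>. Letting first \<open>P\<close> tend to infinity and then
  \<open>d\<close> to \<open>0\<close> makes both small.\<close>

lemma left_detour_integral_bound:
  fixes F :: "complex \<Rightarrow> complex"
  assumes R: "R > 0" and d: "0 < d" "d \<le> R" and P: "P \<ge> 1" and V: "open V" "F holomorphic_on V"
      "path_image (left_detour R d) \<subseteq> V" "0 \<in> V"
    and M: "\<And>z. - d \<le> Re z \<Longrightarrow> Re z \<le> 0 \<Longrightarrow> \<bar>Im z\<bar> \<le> R \<Longrightarrow> norm (F z) \<le> M"
  shows "norm (contour_integral (left_detour R d)
      (\<lambda>z. F z * exp (z * of_real (ln P)) * (1 + z\<^sup>2 / of_real (R\<^sup>2)) / z))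
      \<le> 10 * M * d / R + 10 * M * R * P powr (- d) / d"
proof -
  define f where "f = (\<lambda>z. F z * exp (z * of_real (ln P)) * (1 + z\<^sup>2 / of_real (R\<^sup>2)) / z)"
  have z0: "0 \<notin> path_image (left_detour R d)"
    using left_detour_image[OF R d(1), of 0] R d by auto
  have M0: "M \<ge> 0" using norm_ge_zero[of "F 0"] M[of 0] R d by (simp del: norm_ge_zero)
  have int: "f contour_integrable_on g" if "valid_path g" "path_image g \<subseteq> path_image (left_detour R d)"
      for g
    unfolding f_def using that V z0
    by (intro contour_integrable_holomorphic_simple[where S = "V - {0}"])
       (auto intro!: holomorphic_intros holomorphic_on_subset[OF V(2)])
  have fbound: "norm (f z) \<le> 5 * M * P powr Re z / r"
    if z: "- d \<le> Re z" "Re z \<le> 0" "\<bar>Im z\<bar> \<le> R" and r: "r > 0" "r \<le> norm z" for z r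
  proof -
    have "norm z \<le> R + R" using cmod_le[of z] z d by linarith
    hence "norm (z\<^sup>2 / of_real (R\<^sup>2)) \<le> (R + R)\<^sup>2 / R\<^sup>2"
      unfolding norm_divide norm_power norm_of_real using R
      by (intro frac_le power_mono) auto
    also have "\<dots> = 4" using R by (simp add: power2_eq_square field_simps)
    finally have K: "norm (1 + z\<^sup>2 / of_real (R\<^sup>2)) \<le> 5"
      using norm_triangle_ineq[of 1 "z\<^sup>2 / of_real (R\<^sup>2)"] by simp
    have "norm (f z) = norm (F z) * P powr Re z * norm (1 + z\<^sup>2 / of_real (R\<^sup>2)) / norm z"
      unfolding f_def norm_mult norm_divide using norm_exp_times_ln[of P z] P by simp
    also have "\<dots> \<le> M * P powr Re z * 5 / r"
      using K M[OF z] M0 r by (intro frac_le mult_mono) auto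
    finally show ?thesis by (simp add: mult_ac)
  qed
  let ?a = "linepath (Complex 0 R) (Complex (- d) R)"
  let ?b = "linepath (Complex (- d) R) (Complex (- d) (- R))"
  let ?c = "linepath (Complex (- d) (- R)) (Complex 0 (- R))"
  have images: "path_image (left_detour R d) = path_image ?a \<union> path_image ?b \<union> path_image ?c"
    by (simp add: left_detour_def path_image_join Un_assoc)
  have int_abc: "f contour_integrable_on ?a" "f contour_integrable_on ?b" "f contour_integrable_on ?c"
    using images by (auto intro!: int simp del: path_image_linepath)
  have horizontal: "norm (f z) \<le> 5 * M / R" if "z \<in> path_image ?a \<union> path_image ?c" for z
  proof -
    have "\<bar>Im z\<bar> = R" using that R by (auto dest!: closed_segment_complex)
    moreover have *: "- d \<le> Re z" "Re z \<le> 0" "\<bar>Im z\<bar> \<le> R"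
      using left_detour_image[OF R d(1), of z] that images by auto
    ultimately have "norm (f z) \<le> 5 * M * P powr Re z / R"
      using R abs_Im_le_cmod[of z] by (intro fbound) auto
    also have "\<dots> \<le> 5 * M * 1 / R"
      using powr_mono[of "Re z" 0 P] * P R M0 by (intro divide_right_mono mult_left_mono) auto
    finally show ?thesis by simp
  qed
  have vertical: "norm (f z) \<le> 5 * M * P powr (- d) / d" if "z \<in> path_image ?b" for z
  proof -
    have Re: "Re z = - d" using that by (auto dest!: closed_segment_complex)
    moreover have "\<bar>Im z\<bar> \<le> R"
      using left_detour_image[OF R d(1), of z] that images by auto
    ultimately have "norm (f z) \<le> 5 * M * P powr Re z / d"
      using d abs_Re_le_cmod[of z] by (intro fbound) auto
    thus ?thesis using Re by simp
  qed
  have "contour_integral (left_detour R d) f =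
      contour_integral ?a f + (contour_integral ?b f + contour_integral ?c f)"
    unfolding left_detour_def using int_abc by simp
  moreover have "norm (contour_integral ?a f) \<le> 5 * M / R * norm (Complex (- d) R - Complex 0 R)"
    using horizontal M0 R images by (intro contour_integral_bound_linepath int) auto
  moreover have "norm (contour_integral ?c f) \<le> 5 * M / R * norm (Complex 0 (- R) - Complex (- d) (- R))"
    using horizontal M0 R images by (intro contour_integral_bound_linepath int) auto
  moreover have "norm (contour_integral ?b f)
      \<le> 5 * M * P powr (- d) / d * norm (Complex (- d) (- R) - Complex (- d) R)"
    using vertical M0 d images by (intro contour_integral_bound_linepath int) auto
  moreover have "norm (Complex (- d) R - Complex 0 R) = d" "norm (Complex 0 (- R) - Complex (- d) (- R))
      = d"
      "norm (Complex (- d) (- R) - Complex (- d) R) = 2 * R"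
    using R d by (auto simp: cmod_def real_sqrt_mult)
  ultimately have "norm (contour_integral (left_detour R d) f)
      \<le> 5 * M / R * d + (5 * M * P powr (- d) / d * (2 * R) + 5 * M / R * d)"
    by (metis (no_types, lifting) add_mono norm_triangle_le)
  also have "\<dots> = 10 * M * d / R + 10 * M * R * P powr (- d) / d"
    by (simp add: algebra_simps)
  finally show ?thesis unfolding f_def .
qed


text \<open>The hypothesis on \<open>u n\<close> is the bound for the integral of \<open>f(x) x\<^bsup>-z-1\<^esup>\<close> over
  \<open>[n + 1, n + 2]\<close> when \<open>\<bar>f\<bar> \<le> C\<close>. It telescopes: with \<open>P = N + 1\<close>, partial sums on the left and
  tails on the right are at most \<open>C P\<^bsup>-Re z\<^esup> / \<bar>Re z\<bar>\<close>. By Cauchy's formula, \<open>2\<pi>\<i>\<close> times the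
  difference \<open>F(0) - S\<^sub>N(0)\<close> is the integral of the tail over the right half circle of radius
  \<open>R\<close>, plus that of \<open>F\<close> over the detour, minus that of the entire function \<open>S\<^sub>N\<close> over the left
  half circle, each against \<open>P\<^sup>z\<close> and Newman's kernel. The half circles contribute \<open>O(C / R)\<close> for
  every \<open>N\<close>, and the detour is negligible for large \<open>N\<close>.\<close>

theorem newman_tauberian:
  fixes u :: "nat \<Rightarrow> complex \<Rightarrow> complex" and F :: "complex \<Rightarrow> complex" and C :: real
  assumes entire: "\<And>n. u n holomorphic_on UNIV" and C: "C \<ge> 0"
    and bound: "\<And>n z. Re z \<noteq> 0 \<Longrightarrow>
      norm (u n z) \<le> C * ((real (Suc n) powr (- Re z) - real (Suc (Suc n)) powr (- Re z)) / Re z)"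
    and U: "open U" "{z. Re z \<ge> 0} \<subseteq> U" and F: "F holomorphic_on U"
    and sums: "\<And>z. Re z > 0 \<Longrightarrow> (\<lambda>n. u n z) sums F z"
  shows "(\<lambda>n. u n 0) sums F 0"
proof -
  define S where "S = (\<lambda>N z. \<Sum>n<N. u n z)"
  have S_hol: "S N holomorphic_on UNIV" for N
    unfolding S_def by (intro holomorphic_intros entire)
  have S_bound: "norm (S N z) \<le> C * real (Suc N) powr (- Re z) / \<bar>Re z\<bar>" if z: "Re z < 0" for N z
  proof -
    define a where "a = (\<lambda>n. real (Suc n) powr (- Re z))"
    have "norm (S N z) \<le> (\<Sum>n<N. C * ((a n - a (Suc n)) / Re z))"
      unfolding S_def a_def using z by (intro sum_norm_le bound) auto
    also have "\<dots> = C * ((a 0 - a N) / Re z)"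
      by (simp only: sum_distrib_left [symmetric] sum_divide_distrib [symmetric] sum_lessThan_telescope')
    also have "(a 0 - a N) / Re z = (a N - 1) / \<bar>Re z\<bar>"
      using z by (simp add: a_def field_simps)
    also have "C * \<dots> \<le> C * (a N / \<bar>Re z\<bar>)"
      using C by (intro mult_left_mono divide_right_mono) auto
    finally show ?thesis by (simp add: a_def)
  qed
  have tail_bound: "norm (F z - S N z) \<le> C * real (Suc N) powr (- Re z) / \<bar>Re z\<bar>"
    if z: "Re z > 0" for N z
  proof -
    define a where "a = (\<lambda>n. real (Suc n) powr (- Re z))"
    have "a \<longlonglongrightarrow> 0" unfolding a_def using z
      by (intro tendsto_neg_powr filterlim_compose[OF filterlim_real_sequentially filterlim_Suc]) auto
    hence "(\<lambda>n. a (n + N)) \<longlonglongrightarrow> 0" by (rule LIMSEQ_ignore_initial_segment)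
    hence "(\<lambda>n. a (n + N) - a (Suc n + N)) sums (a (0 + N) - 0)" by (rule telescope_sums')
    hence *: "(\<lambda>n. C * ((a (n + N) - a (Suc (n + N))) / Re z)) sums (C * (a N / Re z))"
      by (intro sums_mult sums_divide) simp
    have "F z - S N z = (\<Sum>n. u (n + N) z)"
      using sums_unique[OF sums[OF z]] suminf_minus_initial_segment[OF sums_summable[OF sums[OF z]], of N]
      by (simp add: S_def)
    also have "norm \<dots> \<le> (\<Sum>n. C * ((a (n + N) - a (Suc (n + N))) / Re z))"
    proof (rule norm_suminf_le)
      show "norm (u (n + N) z) \<le> C * ((a (n + N) - a (Suc (n + N))) / Re z)" for n
        using bound[of z "n + N"] z unfolding a_def by simp
    qed (rule sums_summable[OF *])
    also have "\<dots> = C * (a N / Re z)" using sums_unique[OF *] by simp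
    finally show ?thesis using z by (simp add: a_def)
  qed

  have "\<forall>\<^sub>F N in sequentially. norm (S N 0 - F 0) < e" if e: "e > 0" for e
  proof -
    \<comment> \<open>the half circles will contribute at most \<open>2 C / R\<close>, which this radius makes less than \<open>e / 2\<close>\<close>
    define R where "R = 4 * C / e + 1"
    have R: "R > 0" using C e by (auto simp: R_def intro!: add_nonneg_pos)
    have R_e: "2 * C / R < e / 2" using R C e by (simp add: R_def field_simps)
    \<comment> \<open>by compactness, \<open>U\<close> contains a convex neighbourhood \<open>V\<close> of the right half disc and of a thin
        rectangle\<close>
    define A where "A = (\<lambda>y. Complex 0 y) ` {- (R + 1)..R + 1}"
    have "compact A" unfolding A_def Complex_eq
      by (intro compact_continuous_image continuous_intros) auto
    moreover have "A \<subseteq> U" using U(2) by (auto simp: A_def)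
    ultimately obtain d1 where d1: "d1 > 0" "(\<Union>x\<in>A. ball x d1) \<subseteq> U"
      using compact_subset_open_imp_ball_epsilon_subset[OF _ U(1)] by metis
    define V where "V = {z. Re z > - d1} \<inter> ({z. Im z < R + 1} \<inter> {z. Im z > - (R + 1)})"
    have V: "convex V" "open V" "0 \<in> V"
      using d1 R unfolding V_def
      by (auto intro!: convex_Int open_Int convex_halfspace_Re_gt convex_halfspace_Im_lt
          convex_halfspace_Im_gt open_halfspace_Re_gt open_halfspace_Im_lt open_halfspace_Im_gt)
    have "V \<subseteq> U"
    proof
      fix z assume z: "z \<in> V"
      show "z \<in> U"
      proof (cases "Re z \<ge> 0")
        case False
        have "Complex 0 (Im z) \<in> A" using z by (auto simp: A_def V_def)
        moreover have "dist (Complex 0 (Im z)) z < d1"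
          using z False by (auto simp: V_def dist_norm cmod_def)
        ultimately have "z \<in> (\<Union>x\<in>A. ball x d1)" by (intro UN_I[of "Complex 0 (Im z)"]) auto
        thus ?thesis using d1(2) by blast
      qed (use U in auto)
    qed
    hence F: "F holomorphic_on V" using F holomorphic_on_subset by blast
    define d0 where "d0 = min (d1 / 2) R"
    have d0: "0 < d0" "d0 < d1" "d0 \<le> R" using d1 R by (auto simp: d0_def)
    define B where "B = cbox (Complex (- d0) (- R)) (Complex 0 R)"
    have "B \<subseteq> V" using d0 by (auto simp: B_def V_def in_cbox_complex_iff)
    hence "compact (F ` B)"
      unfolding B_def using F
      by (intro compact_continuous_image holomorphic_on_imp_continuous_on) (auto intro:
          holomorphic_on_subset)
    then obtain M where M: "M > 0" "\<And>z. z \<in> B \<Longrightarrow> norm (F z) \<le> M"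
      using compact_imp_bounded bounded_pos by (metis imageI)
    \<comment> \<open>the width for which the horizontal sides of the detour contribute at most \<open>e / 2\<close>\<close>
    define d where "d = min d0 (e * R / (20 * M))"
    have d: "0 < d" "d \<le> d0" "d \<le> e * R / (20 * M)"
      using d0 e R M by (auto simp: d_def)
    have detour_V: "path_image (left_detour R d) \<subseteq> V"
    proof
      fix z assume "z \<in> path_image (left_detour R d)"
      thus "z \<in> V" using left_detour_image[OF R d(1), of z] d d0 by (auto simp: V_def)
    qed
    have slits: "path_image (left_detour R d) \<inter> \<real>\<^sub>\<ge>\<^sub>0 = {}" "path_image (left_arc R) \<inter> \<real>\<^sub>\<ge>\<^sub>0 = {}"
    proof -
      have "z \<notin> \<real>\<^sub>\<ge>\<^sub>0" if "z \<in> path_image (left_detour R d)" for z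
        using left_detour_image[OF R d(1) that] d R by (auto simp: complex_nonneg_Reals_iff)
      moreover have "z \<notin> \<real>\<^sub>\<ge>\<^sub>0" if "z \<in> path_image (left_arc R)" for z
        using left_arc_image[OF R that] R by (auto simp: complex_nonneg_Reals_iff cmod_def)
      ultimately show "path_image (left_detour R d) \<inter> \<real>\<^sub>\<ge>\<^sub>0 = {}" "path_image (left_arc R) \<inter> \<real>\<^sub>\<ge>\<^sub>0 = {}"
        by blast+
    qed
    have arc_V: "path_image (right_arc R) \<subseteq> V"
    proof
      fix z assume "z \<in> path_image (right_arc R)"
      thus "z \<in> V" using right_arc_image[OF R, of z] abs_Im_le_cmod[of z] d1 by (auto simp: V_def)
    qed
    have arc0: "0 \<notin> path_image (right_arc R)" "0 \<notin> path_image (left_arc R)"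
      using right_arc_image[OF R, of 0] left_arc_image[OF R, of 0] R by auto

    have main: "norm (S N 0 - F 0) \<le> 2 * C / R + (e / 2
        + 10 * M * R / d * real (Suc N) powr (- d)) / (2 * pi)"
      for N
    proof -
      define P where "P = real (Suc N)"
      have P: "P \<ge> 1" "P > 0" by (auto simp: P_def)
      define k :: "(complex \<Rightarrow> complex) \<Rightarrow> complex \<Rightarrow> complex"
        where "k = (\<lambda>h z. h z * exp (z * of_real (ln P)) * (1 + z\<^sup>2 / of_real (R\<^sup>2)) / z)"
      have int: "k h contour_integrable_on g"
        if "h holomorphic_on W" "open W" "valid_path g" "path_image g \<subseteq> W" "0 \<notin> path_image g" for h W g
        unfolding k_def using that R
        by (intro contour_integrable_holomorphic_simple[where S = "W - {0}"])
           (auto intro!: holomorphic_intros holomorphic_on_subset[OF that(1)])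
      have loopF: "contour_integral (right_arc R) (k F) + contour_integral (left_detour R d) (k F)
          = 2 * pi * \<i> * F 0"
        unfolding k_def using V arc_V detour_V slits F R
        by (subst half_circle_loop_formula) (auto intro!: holomorphic_intros)
      have loopS: "contour_integral (right_arc R) (k (S N)) + contour_integral (left_arc R) (k (S N))
          = 2 * pi * \<i> * S N 0"
        unfolding k_def using slits S_hol[of N] R
        by (subst half_circle_loop_formula[where V = UNIV]) (auto intro!: holomorphic_intros)
      have "contour_integral (right_arc R) (k F) - contour_integral (right_arc R) (k (S N)) =
          contour_integral (right_arc R) (\<lambda>z. k F z - k (S N) z)"
        using int[OF F V(2)] int[OF S_hol] arc_V arc0
        by (intro contour_integral_diff [symmetric]) auto
      also have "(\<lambda>z. k F z - k (S N) z) = k (\<lambda>z. F z - S N z)"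
        by (auto simp: k_def fun_eq_iff diff_divide_distrib left_diff_distrib)
      finally have diff: "contour_integral (right_arc R) (k F) - contour_integral (right_arc R) (k (S N)) =
          contour_integral (right_arc R) (k (\<lambda>z. F z - S N z))" .
      have right: "norm (contour_integral (right_arc R) (k (\<lambda>z. F z - S N z)))
          \<le> 2 * C / R\<^sup>2 * R * (pi / 2 - (- (pi / 2)))"
        unfolding right_arc_def
      proof (rule has_contour_integral_bound_part_circlepath[OF has_contour_integral_integral])
        show "k (\<lambda>z. F z - S N z) contour_integrable_on part_circlepath 0 R (- (pi / 2)) (pi / 2)"
          using int[of "\<lambda>z. F z - S N z" V "right_arc R"] F S_hol[of N] V arc_V arc0
          by (auto simp: right_arc_def intro!: holomorphic_intros intro: holomorphic_on_subset)
        fix z assume "z \<in> path_image (part_circlepath 0 R (- (pi / 2)) (pi / 2))"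
        hence "norm z = R" "Re z \<ge> 0" using right_arc_image[OF R] by (auto simp: right_arc_def)
        thus "norm (k (\<lambda>z. F z - S N z) z) \<le> 2 * C / R\<^sup>2"
          unfolding k_def using tail_bound[of z N]
          by (intro newman_arc_bound[OF R P(2) C]) (auto simp: P_def)
      qed (use C R in auto)
      have left: "norm (contour_integral (left_arc R) (k (S N))) \<le> 2 * C / R\<^sup>2 * R * (3 * pi / 2 - pi / 2)"
        unfolding left_arc_def
      proof (rule has_contour_integral_bound_part_circlepath[OF has_contour_integral_integral])
        show "k (S N) contour_integrable_on part_circlepath 0 R (pi / 2) (3 * pi / 2)"
          using int[OF S_hol, of "left_arc R" N] arc0 by (auto simp: left_arc_def)
        fix z assume "z \<in> path_image (part_circlepath 0 R (pi / 2) (3 * pi / 2))"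
        hence "norm z = R" "Re z \<le> 0" using left_arc_image[OF R] by (auto simp: left_arc_def)
        thus "norm (k (S N) z) \<le> 2 * C / R\<^sup>2"
          unfolding k_def using S_bound[of z N]
          by (intro newman_arc_bound[OF R P(2) C]) (auto simp: P_def)
      qed (use C R in auto)
      have detour: "norm (contour_integral (left_detour R d) (k F)) \<le> 10 * M * d / R
          + 10 * M * R * P powr (- d) / d"
        unfolding k_def using d d0 V F detour_V P R
        by (intro left_detour_integral_bound) (auto intro!: M simp: B_def in_cbox_complex_iff)
      have "2 * pi * \<i> * (F 0 - S N 0) = contour_integral (right_arc R) (k (\<lambda>z. F z - S N z))
          + contour_integral (left_detour R d) (k F) - contour_integral (left_arc R) (k (S N))"
        unfolding right_diff_distrib loopF [symmetric] loopS [symmetric] diff [symmetric] by simp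
      also have "norm \<dots> \<le> 2 * C / R\<^sup>2 * R * (pi / 2 - (- (pi / 2)))
          + (10 * M * d / R + 10 * M * R * P powr (- d) / d) + 2 * C / R\<^sup>2 * R * (3 * pi / 2 - pi / 2)"
        by (intro norm_triangle_le_diff norm_triangle_le add_mono right left detour)
      also have "\<dots> = 2 * pi * (2 * C / R) + (10 * M * d / R + 10 * M * R / d * P powr (- d))"
        using R by (simp add: power2_eq_square field_simps)
      also have "10 * M * d / R \<le> e / 2"
        using d(3) M R by (simp add: field_simps)
      also have "norm (2 * pi * \<i> * (F 0 - S N 0)) = 2 * pi * norm (S N 0 - F 0)"
        by (simp add: norm_mult norm_minus_commute)
      finally show ?thesis using pi_gt_zero by (simp add: P_def field_simps)
    qed
    have "(\<lambda>N. real (Suc N) powr (- d)) \<longlonglongrightarrow> 0" using d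
      by (intro tendsto_neg_powr filterlim_compose[OF filterlim_real_sequentially filterlim_Suc]) auto
    hence "(\<lambda>N. 2 * C / R + (e / 2 + 10 * M * R / d * real (Suc N) powr (- d)) / (2 * pi))
        \<longlonglongrightarrow> 2 * C / R + (e / 2 + 10 * M * R / d * 0) / (2 * pi)"
      by (intro tendsto_intros) auto
    moreover have "2 * C / R + (e / 2 + 10 * M * R / d * 0) / (2 * pi) < e"
    proof -
      have "e / 2 / (2 * pi) \<le> e / 2" using e pi_gt3 by (simp add: field_simps)
      thus ?thesis using R_e by simp
    qed
    ultimately have "\<forall>\<^sub>F N in sequentially.
        2 * C / R + (e / 2 + 10 * M * R / d * real (Suc N) powr (- d)) / (2 * pi) < e"
      by (rule order_tendstoD)
    thus ?thesis by eventually_elim (use main in \<open>auto intro: le_less_trans\<close>)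
  qed
  thus ?thesis
    unfolding sums_def S_def tendsto_iff dist_norm by blast
qed

section \<open>Mellin transforms of summatory functions\<close>

text \<open>One cell of the Mellin transform of \<open>A(x) - x\<close>, where \<open>A\<close> is a step function with the
  value \<open>c\<close> on \<open>[n, n + 1)\<close>.\<close>

definition mellin_cell :: "nat \<Rightarrow> real \<Rightarrow> complex \<Rightarrow> complex" where
  "mellin_cell n c s =
     integral (cbox (real n) (real n + 1)) (\<lambda>x. of_real (c - x) * of_real x powr (- s - 1))"

lemma mellin_cell_holomorphic:
  assumes "n > 0" shows "mellin_cell n c holomorphic_on UNIV"
  unfolding mellin_cell_def
proof (rule leibniz_rule_holomorphic)
  fix s :: complex and x assume x: "x \<in> cbox (real n) (real n + 1)"
  show "((\<lambda>s. of_real (c - x) * of_real x powr (- s - 1)) has_field_derivative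
      (- of_real (c - x) * of_real (ln x) * of_real x powr (- s - 1))) (at s within UNIV)"
    using x assms by (auto intro!: derivative_eq_intros simp: powr_def Ln_of_real algebra_simps)
next
  show "continuous_on (UNIV \<times> cbox (real n) (real n + 1))
      (\<lambda>(s, x). - complex_of_real (c - x) * of_real (ln x) * of_real x powr (- s - 1))"
    using assms unfolding case_prod_unfold
        by (intro continuous_intros) (auto simp: complex_nonpos_Reals_iff)
next
  fix s :: complex
  show "(\<lambda>x. complex_of_real (c - x) * of_real x powr (- s - 1)) integrable_on cbox (real n) (real n + 1)"
    using assms by (intro integrable_continuous continuous_intros) (auto simp: complex_nonpos_Reals_iff)
qed auto

lemma mellin_cell_has_integral:
  assumes "n > 0"
  shows "((\<lambda>x. of_real (c - x) * of_real x powr (- s - 1)) has_integral mellin_cell n c s) {real n..real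
      n + 1}"
proof -
  have "(\<lambda>x. complex_of_real (c - x) * of_real x powr (- s - 1)) integrable_on cbox (real n) (real n + 1)"
    using assms by (intro integrable_continuous continuous_intros) (auto simp: complex_nonpos_Reals_iff)
  thus ?thesis unfolding mellin_cell_def by (simp add: has_integral_integral)
qed

lemma has_integral_powr_minus:
  assumes "0 < a" "a \<le> b" "p \<noteq> 1"
  shows "((\<lambda>x. x powr (- p)) has_integral (a powr (1 - p) - b powr (1 - p)) / (p - 1)) {a..b :: real}"
proof -
  have "((\<lambda>x. x powr (- p)) has_integral (- (b powr (1 - p)) / (p - 1) - (- (a powr (1 - p)) / (p -
      1)))) {a..b}"
  proof (rule fundamental_theorem_of_calculus)
    fix x assume "x \<in> {a..b}"
    hence "((\<lambda>x. - (x powr (1 - p)) / (p - 1)) has_real_derivative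
        (- ((1 - p) * x powr (1 - p - 1)) / (p - 1))) (at x within {a..b})"
      using assms by (auto intro!: derivative_eq_intros)
    also have "- ((1 - p) * x powr (1 - p - 1)) / (p - 1) = x powr (- p)"
      using assms by (simp add: divide_simps) (simp add: algebra_simps)
    finally show "((\<lambda>x. - (x powr (1 - p)) / (p - 1)) has_vector_derivative x powr (- p)) (at x within
        {a..b})"
      by (simp add: has_real_derivative_iff_has_vector_derivative)
  qed (use assms in auto)
  thus ?thesis by (simp add: diff_divide_distrib)
qed

lemma norm_mellin_cell_le_integral:
  assumes "n > 0" and le: "\<And>x. x \<in> {real n..real n + 1} \<Longrightarrow> \<bar>c - x\<bar> * x powr (- Re s - 1) \<le> h x"
    and h: "(h has_integral J) {real n..real n + 1}"
  shows "norm (mellin_cell n c s) \<le> J"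
proof -
  have "norm (mellin_cell n c s) \<le> integral {real n..real n + 1} h"
    unfolding integral_unique[OF mellin_cell_has_integral[OF \<open>n > 0\<close>], symmetric]
  proof (rule integral_norm_bound_integral)
    fix x assume x: "x \<in> {real n..real n + 1}"
    hence "norm (of_real x powr (- s - 1)) = x powr (- Re s - 1)"
      using assms(1) by (subst norm_powr_real_powr) auto
    thus "norm (complex_of_real (c - x) * of_real x powr (- s - 1)) \<le> h x"
      using le[OF x] by (simp add: norm_mult flip: of_real_diff)
  qed (use h mellin_cell_has_integral[OF assms(1)] in \<open>auto simp: has_integral_iff\<close>)
  thus ?thesis using h by (simp add: integral_unique)
qed

text \<open>The right-hand side is kept in the telescoping form that Newman's theorem asks for.\<close>

lemma norm_mellin_cell_linear_bound:
  assumes "n > 0" "C \<ge> 0" and le: "\<And>x. x \<in> {real n..real n + 1} \<Longrightarrow> \<bar>c - x\<bar> \<le> C * x" and s: "Re s \<noteq> 1"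
  shows "norm (mellin_cell n c s)
    \<le> C * ((real n powr (1 - Re s) - real (Suc n) powr (1 - Re s)) / (Re s - 1))"
proof (rule norm_mellin_cell_le_integral[OF assms(1)])
  fix x assume x: "x \<in> {real n..real n + 1}"
  have "\<bar>c - x\<bar> * x powr (- Re s - 1) \<le> C * x * x powr (- Re s - 1)"
    using le[OF x] by (intro mult_right_mono) auto
  also have "\<dots> = C * x powr (- Re s)"
    using x assms(1) powr_mult_base[of x "- Re s - 1"] by simp
  finally show "\<bar>c - x\<bar> * x powr (- Re s - 1) \<le> C * x powr (- Re s)" .
next
  have "((\<lambda>x. x powr (- Re s)) has_integral
      ((real n powr (1 - Re s) - real (Suc n) powr (1 - Re s)) / (Re s - 1))) {real n..real n + 1}"
    using has_integral_powr_minus[of "real n" "real n + 1" "Re s"] assms by (simp add: add_ac)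
  thus "((\<lambda>x. C * x powr (- Re s)) has_integral
    C * ((real n powr (1 - Re s) - real (Suc n) powr (1 - Re s)) / (Re s - 1))) {real n..real n + 1}"
    by (rule has_integral_mult_right)
qed

text \<open>For \<open>c = n\<close> the factor \<open>\<bar>c - x\<bar>\<close> is at most \<open>1\<close> on the cell, which gains a power of
  \<open>n\<close> and makes the cells summable for \<open>Re s > 0\<close>.\<close>

lemma norm_mellin_cell_nat_bound:
  assumes "n > 0" "Re s \<ge> - 1"
  shows "norm (mellin_cell n (real n) s) \<le> real n powr (- Re s - 1)"
proof (rule norm_mellin_cell_le_integral[OF assms(1)])
  fix x assume x: "x \<in> {real n..real n + 1}"
  have "\<bar>real n - x\<bar> * x powr (- Re s - 1) \<le> 1 * real n powr (- Re s - 1)"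
    using x assms by (intro mult_mono powr_mono2') auto
  thus "\<bar>real n - x\<bar> * x powr (- Re s - 1) \<le> real n powr (- Re s - 1)" by simp
next
  show "((\<lambda>x. real n powr (- Re s - 1)) has_integral real n powr (- Re s - 1)) {real n..real n + 1}"
    using has_integral_const_real[of "real n powr (- Re s - 1)" "real n" "real n + 1"] by simp
qed

lemma mellin_cell_eq:
  assumes "n > 0" "s \<noteq> 0" "s \<noteq> 1"
  shows "mellin_cell n c s =
    of_real c * (of_nat n powr (- s) - of_nat (Suc n) powr (- s)) / s
    - (of_nat n powr (1 - s) - of_nat (Suc n) powr (1 - s)) / (s - 1)"
proof -
  define G where "G = (\<lambda>z. - of_real c * z powr (- s) / s + z powr (1 - s) / (s - 1))"
  have "((\<lambda>x. of_real (c - x) * of_real x powr (- s - 1)) has_integral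
      (G (of_real (real n + 1)) - G (of_real (real n)))) {real n..real n + 1}"
  proof (rule fundamental_theorem_of_calculus)
    fix x assume x: "x \<in> {real n..real n + 1}"
    hence x0: "x > 0" using assms by auto
    hence "(G has_field_derivative
        (- of_real c * (- s * of_real x powr (- s - 1)) / s
            + (1 - s) * of_real x powr (1 - s - 1) / (s - 1)))
        (at (of_real x))"
      unfolding G_def using assms
      by (intro DERIV_add DERIV_cdivide DERIV_cmult has_field_derivative_powr)
        (auto simp: complex_nonpos_Reals_iff)
    also have "(1 - s) * of_real x powr (1 - s - 1) / (s - 1) = - (of_real x powr (- s))"
      using assms by (simp add: divide_simps) (simp add: algebra_simps)
    also have "of_real x powr (- s) = of_real x * (of_real x :: complex) powr (- s - 1)"
      using x0 by (simp add: powr_diff)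
    also have "- of_real c * (- s * of_real x powr (- s - 1)) / s + - (of_real x * of_real x powr (- s - 1))
        = of_real (c - x) * of_real x powr (- s - 1)"
      using assms by (simp add: algebra_simps)
    finally show "((\<lambda>x. G (of_real x)) has_vector_derivative (of_real (c - x) * of_real x powr (- s - 1)))
        (at x within {real n..real n + 1})"
      by (rule has_vector_derivative_real_field)
  qed auto
  hence "mellin_cell n c s = G (of_real (real n + 1)) - G (of_real (real n))"
    using mellin_cell_has_integral[OF assms(1)] has_integral_unique by blast
  also have "\<dots> = of_real c * (of_nat n powr (- s) - of_nat (Suc n) powr (- s)) / s
    - (of_nat n powr (1 - s) - of_nat (Suc n) powr (1 - s)) / (s - 1)"
    by (simp add: G_def diff_divide_distrib right_diff_distrib add_ac)
  finally show ?thesis .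
qed

lemma partial_summation_identity:
  fixes a :: "nat \<Rightarrow> real" and p :: "nat \<Rightarrow> 'a :: real_algebra_1"
  shows "(\<Sum>n<N. of_real (\<Sum>k=1..Suc n. a k) * (p (Suc n) - p (Suc (Suc n)))) =
     (\<Sum>n<N. of_real (a (Suc n)) * p (Suc n)) - of_real (\<Sum>k=1..N. a k) * p (Suc N)"
  by (induction N) (simp_all add: algebra_simps)

text \<open>Abel summation: with \<open>A(x)\<close> the sum of \<open>a k\<close> over \<open>k \<le> x\<close>, the integral of
  \<open>A(x) x\<^bsup>-s-1\<^esup>\<close> is \<open>1 / s\<close> times the Dirichlet series, and the integral of \<open>x\<^bsup>-s\<^esup>\<close> over \<open>[1, \<infinity>)\<close> is
  \<open>1 / (s - 1)\<close>. The coefficients \<open>1\<close> and \<open>\<Lambda>(n)\<close> are the two cases of interest.\<close>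

lemma mellin_cells_sum_dirichlet:
  fixes a :: "nat \<Rightarrow> real"
  assumes s: "Re s > 1" and C: "\<And>n. \<bar>\<Sum>k=1..n. a k\<bar> \<le> C * real n"
    and D: "(\<lambda>n. of_real (a (Suc n)) * of_nat (Suc n) powr (- s)) sums D"
  shows "(\<lambda>n. mellin_cell (Suc n) (\<Sum>k=1..Suc n. a k) s) sums (D / s - 1 / (s - 1))"
proof -
  define A where "A = (\<lambda>n. \<Sum>k=1..n. a k)"
  have s': "s \<noteq> 0" "s \<noteq> 1" using s by auto
  have powr_0: "(\<lambda>N. real (Suc N) powr (1 - Re s)) \<longlonglongrightarrow> 0" using s
    by (intro tendsto_neg_powr filterlim_compose[OF filterlim_real_sequentially filterlim_Suc]) auto
  have norm_powr: "norm (of_nat (Suc N) powr z :: complex) = real (Suc N) powr Re z" for N z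
    using norm_powr_real_powr[of "of_nat (Suc N)" z] by simp
  have C0: "C \<ge> 0" using C[of 1] by simp
  have 1: "(\<lambda>N. of_real (A N) * (of_nat (Suc N) powr (- s) :: complex)) \<longlonglongrightarrow> 0"
  proof (rule Lim_null_comparison)
    show "\<forall>\<^sub>F N in sequentially. norm (of_real (A N) * (of_nat (Suc N) powr (- s) :: complex))
        \<le> C * real (Suc N) powr (1 - Re s)"
    proof (rule always_eventually, rule allI)
      fix N
      have "norm (of_real (A N) * (of_nat (Suc N) powr (- s) :: complex))
          = \<bar>A N\<bar> * real (Suc N) powr (- Re s)"
        by (simp only: norm_mult norm_of_real norm_powr uminus_complex.sel)
      also have "\<dots> \<le> (C * real (Suc N)) * real (Suc N) powr (- Re s)"
        using C[of N] C0 by (intro mult_right_mono) (auto simp: A_def algebra_simps)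
      also have "\<dots> = C * real (Suc N) powr (1 - Re s)"
        using powr_mult_base[of "real (Suc N)" "- Re s"] by simp
      finally show "norm (of_real (A N) * (of_nat (Suc N) powr (- s) :: complex))
        \<le> C * real (Suc N) powr (1 - Re s)" .
    qed
    show "(\<lambda>N. C * real (Suc N) powr (1 - Re s)) \<longlonglongrightarrow> 0"
      using tendsto_mult_right_zero[OF powr_0] .
  qed
  have 2: "(\<lambda>N. of_nat (Suc N) powr (1 - s) :: complex) \<longlonglongrightarrow> 0"
    by (rule tendsto_norm_zero_cancel) (use powr_0 norm_powr[of _ "1 - s"] in simp)
  have "(\<lambda>N. ((\<Sum>n<N. of_real (a (Suc n)) * of_nat (Suc n) powr (- s)) - of_real (A N) * of_nat (Suc N)
      powr (- s)) / s
      - (1 - of_nat (Suc N) powr (1 - s)) / (s - 1)) \<longlonglongrightarrow> (D - 0) / s - (1 - 0) / (s - 1)"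
    using D unfolding sums_def using s' by (intro tendsto_intros 1 2) auto
  also have "(\<lambda>N. ((\<Sum>n<N. of_real (a (Suc n)) * of_nat (Suc n) powr (- s)) - of_real (A N) * of_nat (Suc
      N) powr (- s)) / s
      - (1 - of_nat (Suc N) powr (1 - s)) / (s - 1)) = (\<lambda>N. \<Sum>n<N. mellin_cell (Suc n) (A (Suc n)) s)"
  proof
    fix N
    have "(\<Sum>n<N. mellin_cell (Suc n) (A (Suc n)) s) =
      (\<Sum>n<N. of_real (A (Suc n)) * (of_nat (Suc n) powr (- s) - of_nat (Suc (Suc n)) powr (- s))) / s
      - (\<Sum>n<N. of_nat (Suc n) powr (1 - s) - of_nat (Suc (Suc n)) powr (1 - s)) / (s - 1)"
      unfolding mellin_cell_eq[OF zero_less_Suc s'] sum_divide_distrib by (rule sum_subtractf)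
    also have "(\<Sum>n<N. of_real (A (Suc n)) * (of_nat (Suc n) powr (- s) - of_nat (Suc (Suc n)) powr (- s)))
        = (\<Sum>n<N. of_real (a (Suc n)) * of_nat (Suc n) powr (- s)) - of_real (A N) * of_nat (Suc N) powr
            (- s)"
      unfolding A_def by (rule partial_summation_identity)
    also have "(\<Sum>n<N. of_nat (Suc n) powr (1 - s) - of_nat (Suc (Suc n)) powr (1 - s)) =
        1 - (of_nat (Suc N) powr (1 - s) :: complex)"
      by (subst sum_lessThan_telescope') simp
    finally show "((\<Sum>n<N. of_real (a (Suc n)) * of_nat (Suc n) powr (- s)) - of_real (A N) * of_nat (Suc
        N) powr (- s)) / s
      - (1 - of_nat (Suc N) powr (1 - s)) / (s - 1) = (\<Sum>n<N. mellin_cell (Suc n) (A (Suc n)) s)" ..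
  qed
  finally show ?thesis by (simp add: sums_def A_def)
qed

section \<open>The zeta function and the Dirichlet series of the von Mangoldt function\<close>

text \<open>Absolute convergence allows the double series over \<open>(d, k)\<close> to be rearranged according
  to the product \<open>n = d k\<close>. The terms at \<open>0\<close> vanish, so only positive products count, and these
  have finitely many divisors.\<close>

lemma dirichlet_convolution_sums:
  fixes f g :: "nat \<Rightarrow> complex"
  assumes f: "summable (\<lambda>n. norm (f n))" and g: "summable (\<lambda>n. norm (g n))"
    and 0: "f 0 = 0" "g 0 = 0"
  shows "(\<lambda>n. \<Sum>d | d dvd n. f d * g (n div d)) sums (suminf f * suminf g)"
proof -
  define h where "h = (\<lambda>(d, k). f d * g k)"
  have fs: "(f has_sum suminf f) UNIV" and gs: "(g has_sum suminf g) UNIV"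
    using f g by (auto intro!: norm_summable_imp_has_sum summable_sums summable_norm_cancel[OF f]
        summable_norm_cancel[OF g])
  have "(\<lambda>x. norm (h x)) summable_on UNIV \<times> UNIV"
  proof (rule summable_on_SigmaI)
    fix d
    show "((\<lambda>k. norm (h (d, k))) has_sum (norm (f d) * (\<Sum>k. norm (g k)))) UNIV"
      using norm_summable_imp_has_sum[of "\<lambda>k. norm (g k)"] g
      by (auto simp: h_def norm_mult intro!: has_sum_cmult_right summable_sums)
    show "(\<lambda>d. norm (f d) * (\<Sum>k. norm (g k))) summable_on UNIV"
      using f by (intro summable_on_cmult_left norm_summable_imp_summable_on) simp
  qed auto
  hence "h summable_on UNIV \<times> UNIV" by (rule abs_summable_summable)
  hence "(h has_sum (suminf f * suminf g)) (UNIV \<times> UNIV)"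
    by (rule has_sum_SigmaI[rotated 2, where g = "\<lambda>d. f d * suminf g"])
      (auto simp: h_def intro!: has_sum_cmult_right has_sum_cmult_left fs gs)
  hence "(h has_sum (suminf f * suminf g)) ({0<..} \<times> {0<..})"
    by (rule has_sum_cong_neutral[THEN iffD1, rotated 3]) (auto simp: h_def 0 intro!: Nat.gr0I)
  also have "(h has_sum (suminf f * suminf g)) ({0<..} \<times> {0<..}) \<longleftrightarrow>
      ((\<lambda>(n, d). f d * g (n div d)) has_sum (suminf f * suminf g)) (Sigma {0<..} (\<lambda>n. {d. d dvd n}))"
    by (rule has_sum_reindex_bij_witness[where i = "\<lambda>(n, d). (d, n div d)" and j = "\<lambda>(d, k). (d * k, d)"])
      (auto simp: h_def intro!: Nat.gr0I)
  finally have "((\<lambda>n. \<Sum>d | d dvd n. f d * g (n div d)) has_sum (suminf f * suminf g)) {0<..}"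
    by (rule has_sum_SigmaD) (auto intro!: has_sum_finite)
  hence "((\<lambda>n. \<Sum>d | d dvd n. f d * g (n div d)) has_sum (suminf f * suminf g)) UNIV"
    by (rule has_sum_cong_neutral[THEN iffD1, rotated 3]) auto
  thus ?thesis by (rule has_sum_imp_sums)
qed

text \<open>The value at \<open>n = 0\<close> is \<open>0\<close>, so a series over all natural numbers is one over the
  positive ones.\<close>

abbreviation nat_power :: "complex \<Rightarrow> nat \<Rightarrow> complex" where
  "nat_power s n \<equiv> of_nat n powr (- s)"

lemma norm_nat_power: "norm (nat_power s n) = real n powr (- Re s)"
proof (cases "n = 0")
  case False
  thus ?thesis using norm_powr_real_powr[of "of_nat n" "- s"] by simp
qed auto

definition zeta_series :: "complex \<Rightarrow> complex" where
  "zeta_series s = (\<Sum>n. nat_power s n)"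

definition mangoldt_series :: "complex \<Rightarrow> complex" where
  "mangoldt_series s = (\<Sum>n. mangoldt n * nat_power s n)"

lemma summable_norm_nat_power: "Re s > 1 \<Longrightarrow> summable (\<lambda>n. norm (nat_power s n))"
  by (simp add: norm_nat_power summable_real_powr_iff)

text \<open>Termwise differentiation; in the ball of radius \<open>(Re s - 1) / 2\<close> the series is
  dominated by the one at the exponent \<open>(1 + Re s) / 2\<close>.\<close>

lemma zeta_series_has_derivative:
  assumes s: "Re s > 1"
  shows "summable (\<lambda>n. of_real (ln (real n)) * nat_power s n)"
    and "(zeta_series has_field_derivative - (\<Sum>n. of_real (ln (real n)) * nat_power s n)) (at s)"
proof -
  define S where "S = {s. Re s > 1}"
  have "\<exists>g g'. \<forall>s\<in>S. ((\<lambda>n. nat_power s n) sums g s) \<and> ((\<lambda>n. - of_real (ln (real n)) * nat_power s n)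
      sums g' s)
      \<and> (g has_field_derivative g' s) (at s)"
  proof (rule series_and_derivative_comparison_local)
    show "open S" by (simp add: S_def open_halfspace_Re_gt)
    show "((\<lambda>s. nat_power s n) has_field_derivative - of_real (ln (real n)) * nat_power s n) (at s)" for n s
      by (cases "n = 0") (auto intro!: derivative_eq_intros simp: powr_def Ln_of_nat)
    fix s assume s: "s \<in> S"
    define t where "t = (1 + Re s) / 2"
    have t: "t > 1" using s by (simp add: t_def S_def)
    have "norm (nat_power y n) \<le> real n powr (- t)" if "y \<in> ball s (t - 1)" for n y
    proof -
      have "Re s - Re y \<le> norm (s - y)" using complex_Re_le_cmod[of "s - y"] by simp
      also have "\<dots> < t - 1" using that by (simp add: dist_norm)
      finally have "Re y \<ge> t" by (simp add: t_def field_simps)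
      thus ?thesis by (cases "n = 0") (auto simp: norm_nat_power intro!: powr_mono)
    qed
    thus "\<exists>d h. 0 < d \<and> summable h \<and> (\<forall>\<^sub>F n in sequentially. \<forall>y\<in>ball s d \<inter> S. norm (nat_power y n) \<le> h n)"
      using t by (intro exI[of _ "t - 1"] exI[of _ "\<lambda>n. real n powr (- t)"])
        (auto simp: summable_real_powr_iff)
  qed
  then obtain g g' where g: "\<And>s. s \<in> S \<Longrightarrow> (\<lambda>n. nat_power s n) sums g s"
      "\<And>s. s \<in> S \<Longrightarrow> (\<lambda>n. - of_real (ln (real n)) * nat_power s n) sums g' s"
      "\<And>s. s \<in> S \<Longrightarrow> (g has_field_derivative g' s) (at s)" by blast
  have sS: "s \<in> S" using s by (simp add: S_def)
  have *: "(\<lambda>n. of_real (ln (real n)) * nat_power s n) sums (- g' s)"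
    using sums_minus[OF g(2)[OF sS]] by simp
  thus "summable (\<lambda>n. of_real (ln (real n)) * nat_power s n)" by (rule sums_summable)
  have eq: "zeta_series s = g s" if "s \<in> S" for s
    using g(1)[OF that] by (simp add: zeta_series_def sums_iff)
  have "(zeta_series has_field_derivative g' s) (at s)"
  proof (rule DERIV_cong_ev[THEN iffD2, OF refl _ refl, OF _ g(3)[OF sS]])
    have "\<forall>\<^sub>F x in nhds s. x \<in> S"
      using sS by (intro eventually_nhds_in_open) (auto simp: S_def open_halfspace_Re_gt)
    thus "\<forall>\<^sub>F x in nhds s. zeta_series x = g x" by eventually_elim (rule eq)
  qed
  thus "(zeta_series has_field_derivative - (\<Sum>n. of_real (ln (real n)) * nat_power s n)) (at s)"
    using * by (simp add: sums_iff)
qed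

text \<open>Since \<open>\<Lambda>(n) \<le> ln n\<close>, the differentiated zeta series at the real point \<open>Re s\<close> is a
  majorant.\<close>

lemma summable_norm_mangoldt_series:
  assumes "Re s > 1" shows "summable (\<lambda>n. norm (mangoldt n * nat_power s n))"
proof (rule summable_comparison_test)
  have "summable (\<lambda>n. Re (of_real (ln (real n)) * nat_power (of_real (Re s)) n))"
    using zeta_series_has_derivative(1)[of "of_real (Re s)"] assms by (intro summable_Re) auto
  also have "(\<lambda>n. Re (of_real (ln (real n)) * nat_power (of_real (Re s)) n))
      = (\<lambda>n. ln (real n) * real n powr (- Re s))"
    using powr_of_real[of "real n" "- Re s" for n] by (auto simp: fun_eq_iff)
  finally show "summable (\<lambda>n. ln (real n) * real n powr (- Re s))" .
  have "norm (norm (mangoldt n * nat_power s n)) \<le> ln (real n) * real n powr (- Re s)" for n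
  proof (cases "n = 0")
    case False
    thus ?thesis using mangoldt_le[of n]
      by (simp only: norm_mult norm_mangoldt norm_nat_power real_norm_def abs_mult) (auto intro!:
          mult_right_mono)
  qed auto
  thus "\<exists>N. \<forall>n\<ge>N. norm (norm (mangoldt n * nat_power s n)) \<le> ln (real n) * real n powr (- Re s)" by blast
qed

text \<open>The convolution of \<open>\<Lambda>\<close> with the constant \<open>1\<close> is the logarithm.\<close>

lemma mangoldt_series_times_zeta:
  assumes "Re s > 1"
  shows "mangoldt_series s * zeta_series s = (\<Sum>n. of_real (ln (real n)) * nat_power s n)"
proof -
  have "(\<lambda>n. \<Sum>d | d dvd n. mangoldt d * nat_power s d * nat_power s (n div d))
      sums (mangoldt_series s * zeta_series s)"
    unfolding mangoldt_series_def zeta_series_def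
    using assms summable_norm_mangoldt_series summable_norm_nat_power
    by (intro dirichlet_convolution_sums) auto
  also have "(\<lambda>n. \<Sum>d | d dvd n. mangoldt d * nat_power s d * nat_power s (n div d))
      = (\<lambda>n. of_real (ln (real n)) * nat_power s n)"
  proof
    fix n
    show "(\<Sum>d | d dvd n. mangoldt d * nat_power s d * nat_power s (n div d))
        = of_real (ln (real n)) * nat_power s n"
    proof (cases "n = 0")
      case False
      have "nat_power s d * nat_power s (n div d) = nat_power s n" if "d dvd n" for d
      proof -
        obtain k where n: "n = d * k" using \<open>d dvd n\<close> by auto
        hence "d > 0" "k > 0" using False by auto
        thus ?thesis
          using powr_times_real[of "of_nat d" "of_nat k" "- s"] by (simp add: n)
      qed
      hence "(\<Sum>d | d dvd n. mangoldt d * nat_power s d * nat_power s (n div d)) =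
          (\<Sum>d | d dvd n. mangoldt d * nat_power s n)"
        by (intro sum.cong) (auto simp: mult.assoc)
      also have "\<dots> = of_real (ln (real n)) * nat_power s n"
        using False by (simp add: mangoldt_sum flip: sum_distrib_right)
      finally show ?thesis .
    qed auto
  qed
  finally show ?thesis by (simp add: sums_iff)
qed

text \<open>The function \<open>(s - 1) \<zeta>(s)\<close>, in a form that makes sense for \<open>Re s > 0\<close>: it is obtained
  from \<open>\<zeta>(s) = s / (s - 1) + s \<Sum> \<integral> (n - x) x\<^bsup>-s-1\<^esup> dx\<close>. With the pole multiplied away, no point of
  the half-plane needs separate treatment.\<close>

definition zeta_pole_free :: "complex \<Rightarrow> complex" where
  "zeta_pole_free s = s + s * (s - 1) * (\<Sum>n. mellin_cell (Suc n) (real (Suc n)) s)"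

lemma zeta_pole_free_1 [simp]: "zeta_pole_free 1 = 1"
  by (simp add: zeta_pole_free_def)

lemma zeta_pole_free_holomorphic: "zeta_pole_free holomorphic_on {s. Re s > 0}"
proof -
  define S where "S = {s. Re s > 0}"
  define f where "f = (\<lambda>n. mellin_cell (Suc n) (real (Suc n)))"
  have "\<exists>g g'. \<forall>s\<in>S. ((\<lambda>n. f n s) sums g s) \<and> ((\<lambda>n. deriv (f n) s) sums g' s)
      \<and> (g has_field_derivative g' s) (at s)"
  proof (rule series_and_derivative_comparison_local)
    show "open S" by (simp add: S_def open_halfspace_Re_gt)
    show "(f n has_field_derivative deriv (f n) s) (at s)" for n s
      unfolding f_def using mellin_cell_holomorphic[of "Suc n" "real (Suc n)"]
      by (auto intro: holomorphic_derivI)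
    fix s assume s: "s \<in> S"
    define t where "t = Re s / 2"
    have t: "t > 0" using s by (simp add: t_def S_def)
    have "norm (f n y) \<le> real (Suc n) powr (- t - 1)" if "y \<in> ball s t" for n y
    proof -
      have "Re s - Re y \<le> norm (s - y)" using complex_Re_le_cmod[of "s - y"] by simp
      also have "\<dots> < t" using that by (simp add: dist_norm)
      finally have y: "Re y \<ge> t" by (simp add: t_def field_simps)
      have "norm (f n y) \<le> real (Suc n) powr (- Re y - 1)"
        unfolding f_def using y t by (intro norm_mellin_cell_nat_bound) auto
      also have "\<dots> \<le> real (Suc n) powr (- t - 1)"
        using y by (intro powr_mono) auto
      finally show ?thesis .
    qed
    moreover have "summable (\<lambda>n. real (Suc n) powr (- t - 1))"
      using t by (subst summable_Suc_iff) (simp add: summable_real_powr_iff)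
    ultimately show "\<exists>d h. 0 < d \<and> summable h \<and> (\<forall>\<^sub>F n in sequentially. \<forall>y\<in>ball s d \<inter> S. norm (f n y)
        \<le> h n)"
      using t by (intro exI[of _ t] exI[of _ "\<lambda>n. real (Suc n) powr (- t - 1)"]) auto
  qed
  then obtain g g' where g: "\<And>s. s \<in> S \<Longrightarrow> (\<lambda>n. f n s) sums g s"
      "\<And>s. s \<in> S \<Longrightarrow> (g has_field_derivative g' s) (at s)" by blast
  have "g holomorphic_on S"
    using g(2) by (meson field_differentiable_def field_differentiable_at_within holomorphic_onI)
  hence "(\<lambda>s. s + s * (s - 1) * g s) holomorphic_on S" by (intro holomorphic_intros)
  also have "?this \<longleftrightarrow> zeta_pole_free holomorphic_on S"
    using g(1) by (intro holomorphic_cong) (auto simp: zeta_pole_free_def f_def sums_iff)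
  finally show ?thesis by (simp add: S_def)
qed

lemma sums_Suc_nat_power:
  fixes a :: "nat \<Rightarrow> complex"
  assumes "summable (\<lambda>n. norm (a n * nat_power s n))"
  shows "(\<lambda>n. a (Suc n) * nat_power s (Suc n)) sums (\<Sum>n. a n * nat_power s n)"
  using summable_sums[OF summable_norm_cancel[OF assms]]
  by (subst sums_Suc_iff) auto

lemma zeta_pole_free_eq:
  assumes s: "Re s > 1" shows "zeta_pole_free s = (s - 1) * zeta_series s"
proof -
  have "(\<lambda>n. mellin_cell (Suc n) (\<Sum>k=1..Suc n. 1) s) sums (zeta_series s / s - 1 / (s - 1))"
    using sums_Suc_nat_power[of "\<lambda>_. 1" s] summable_norm_nat_power[OF s]
    by (intro mellin_cells_sum_dirichlet[OF s, where C = 1]) (auto simp: zeta_series_def)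
  hence "(\<Sum>n. mellin_cell (Suc n) (real (Suc n)) s) = zeta_series s / s - 1 / (s - 1)"
    by (simp add: sums_iff)
  hence "zeta_pole_free s = s + s * (s - 1) * (zeta_series s / s - 1 / (s - 1))"
    by (simp add: zeta_pole_free_def)
  also have "\<dots> = (s - 1) * zeta_series s"
    using s by (auto simp: divide_simps)
  finally show ?thesis .
qed

text \<open>This is \<open>\<Sum> \<Lambda>(n) n\<^bsup>-s\<^esup> = - \<zeta>'(s) / \<zeta>(s)\<close>, cleared of denominators so that it also speaks
  about zeros.\<close>

lemma mangoldt_series_pole_free:
  assumes s: "Re s > 1"
  shows "mangoldt_series s * ((s - 1) * zeta_pole_free s)
      = zeta_pole_free s - (s - 1) * deriv zeta_pole_free s"
proof -
  have "(zeta_pole_free has_field_derivative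
      (1 - 0) * zeta_series s + (- (\<Sum>n. of_real (ln (real n)) * nat_power s n)) * (s - 1)) (at s)"
  proof (rule DERIV_cong_ev[THEN iffD2, OF refl _ refl])
    have "\<forall>\<^sub>F x in nhds s. x \<in> {s. Re s > 1}"
      using s by (intro eventually_nhds_in_open) (auto simp: open_halfspace_Re_gt)
    thus "\<forall>\<^sub>F x in nhds s. zeta_pole_free x = (x - 1) * zeta_series x"
      by eventually_elim (simp add: zeta_pole_free_eq)
    show "((\<lambda>x. (x - 1) * zeta_series x) has_field_derivative
      (1 - 0) * zeta_series s + (- (\<Sum>n. of_real (ln (real n)) * nat_power s n)) * (s - 1)) (at s)"
      by (intro DERIV_mult DERIV_diff DERIV_ident DERIV_const zeta_series_has_derivative s)
  qed
  hence der: "deriv zeta_pole_free s = zeta_series s - mangoldt_series s * zeta_series s * (s - 1)"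
    using mangoldt_series_times_zeta[OF s] by (simp add: DERIV_imp_deriv)
  show ?thesis
    unfolding der zeta_pole_free_eq[OF s] by (simp add: algebra_simps)
qed

lemma mangoldt_cells_sum:
  assumes s: "Re s > 1"
  shows "(\<lambda>n. mellin_cell (Suc n) (chebyshev_psi (Suc n)) s) sums (mangoldt_series s / s - 1 / (s - 1))"
  unfolding chebyshev_psi_def
proof (rule mellin_cells_sum_dirichlet[OF s, where C = 6])
  show "\<bar>\<Sum>k=1..n. mangoldt k :: real\<bar> \<le> 6 * real n" for n
    using chebyshev_psi_le[of n] chebyshev_psi_nonneg[of n] by (simp add: chebyshev_psi_def)
  show "(\<lambda>n. complex_of_real (mangoldt (Suc n)) * nat_power s (Suc n)) sums mangoldt_series s"
    using sums_Suc_nat_power[of mangoldt s] summable_norm_mangoldt_series[OF s]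
    by (simp add: mangoldt_series_def)
qed

section \<open>Nonvanishing of zeta on the closed half-plane\<close>

text \<open>Factor \<open>f(w) = (w - s)\<^sup>m g(w)\<close> with \<open>g(s) \<noteq> 0\<close>; then \<open>e f'/f = m + e g'/g\<close> at
  \<open>w = s + e\<close>, so the limit is the order of vanishing.\<close>

lemma log_deriv_radial_limit:
  fixes f :: "complex \<Rightarrow> complex"
  assumes f: "f holomorphic_on S" "open S" "connected S" "s \<in> S" 
    and nonconst: "f s = 0 \<Longrightarrow> \<not> f constant_on S"
  obtains m :: nat where "m > 0 \<longleftrightarrow> f s = 0" "\<forall>\<^sub>F e in at_right 0. f (s + of_real e) \<noteq> 0"
    "((\<lambda>e. of_real e * deriv f (s + of_real e) / f (s + of_real e)) \<longlongrightarrow> of_nat m) (at_right 0)"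
proof -
  have "\<exists>m g r. (m > 0 \<longleftrightarrow> f s = 0) \<and> r > 0 \<and> g holomorphic_on ball s r \<and>
      (\<forall>w\<in>ball s r. f w = (w - s) ^ m * g w) \<and> (\<forall>w\<in>ball s r. g w \<noteq> 0)"
  proof (cases "f s = 0")
    case True
    show ?thesis
      by (rule holomorphic_factor_zero_nonconstant[OF f True nonconst[OF True]]) (use True in blast)
  next
    case False
    have "continuous (at s) f"
      using f holomorphic_on_imp_continuous_on continuous_on_eq_continuous_at by blast
    then obtain r1 where r1: "r1 > 0" "\<And>w. dist s w < r1 \<Longrightarrow> f w \<noteq> 0"
      using continuous_at_avoid[of s f 0] False by auto
    obtain r2 where r2: "r2 > 0" "ball s r2 \<subseteq> S" using f openE by blast
    show ?thesis
    proof (intro exI[of _ "0::nat"] exI[of _ f] exI[of _ "min r1 r2"] conjI ballI)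
      have "ball s (min r1 r2) \<subseteq> S" using r2 by auto
      thus "f holomorphic_on ball s (min r1 r2)" using f(1) holomorphic_on_subset by blast
    qed (use r1 r2 False in auto)
  qed
  then obtain m g r where m: "m > 0 \<longleftrightarrow> f s = 0" and r: "r > 0" and g: "g holomorphic_on ball s r"
      "\<And>w. w \<in> ball s r \<Longrightarrow> f w = (w - s) ^ m * g w" "\<And>w. w \<in> ball s r \<Longrightarrow> g w \<noteq> 0"
    by blast
  have near: "\<forall>\<^sub>F e in at_right (0::real). e > 0 \<and> s + of_real e \<in> ball s r"
    using eventually_at_right_real[OF r] by eventually_elim (auto simp: dist_norm)
  have "((\<lambda>e. of_nat m + of_real e * deriv g (s + of_real e) / g (s + of_real e))
      \<longlongrightarrow> of_nat m + of_real 0 * deriv g (s + of_real 0) / g (s + of_real 0)) (at_right 0)"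
  proof -
    have "continuous (at (s + of_real 0)) (deriv g)" "continuous (at (s + of_real 0)) g"
      using g(1) r holomorphic_deriv[OF g(1)]
      by (auto intro!: continuous_on_interior holomorphic_on_imp_continuous_on)
    thus ?thesis
      using r g(3)[of s]
      by (intro tendsto_intros isCont_tendsto_compose[of _ "deriv g"] isCont_tendsto_compose[of _ g]) auto
  qed
  moreover have "\<forall>\<^sub>F e in at_right 0. of_nat m + of_real e * deriv g (s + of_real e) / g (s + of_real e)
      = of_real e * deriv f (s + of_real e) / f (s + of_real e)"
    using near
  proof eventually_elim
    case (elim e)
    define w where "w = s + complex_of_real e"
    have w: "w \<in> ball s r" "w - s = of_real e" using elim by (auto simp: w_def)
    have "(f has_field_derivative (of_nat m * (w - s) ^ (m - 1)) * g w + deriv g w * (w - s) ^ m) (at w)"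
    proof (rule DERIV_cong_ev[THEN iffD2, OF refl _ refl])
      show "\<forall>\<^sub>F x in nhds w. f x = (x - s) ^ m * g x"
        using eventually_nhds_in_open[of "ball s r" w] w g(2) by (auto elim: eventually_mono)
      have "(g has_field_derivative deriv g w) (at w)"
        using g(1) w by (auto intro: holomorphic_derivI)
      thus "((\<lambda>x. (x - s) ^ m * g x) has_field_derivative
          (of_nat m * (w - s) ^ (m - 1)) * g w + deriv g w * (w - s) ^ m) (at w)"
        by (auto intro!: derivative_eq_intros)
    qed
    hence "deriv f w = (of_nat m * (w - s) ^ (m - 1)) * g w + deriv g w * (w - s) ^ m"
      by (rule DERIV_imp_deriv)
    hence "of_real e * deriv f w = of_nat m * (w - s) ^ m * g w + of_real e * deriv g w * (w - s) ^ m"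
      unfolding w(2) by (cases m) (auto simp: algebra_simps)
    thus ?case
      using elim g(2)[OF w(1)] g(3)[OF w(1)] w(2)
          by (simp add: w_def [symmetric] divide_simps) (simp add: algebra_simps)
  qed
  ultimately have "((\<lambda>e. of_real e * deriv f (s + of_real e) / f (s + of_real e)) \<longlongrightarrow> of_nat m) (at_right 0)"
    by (simp add: Lim_transform_eventually)
  moreover have "\<forall>\<^sub>F e in at_right 0. f (s + of_real e) \<noteq> 0"
    using near by eventually_elim (auto simp: g)
  ultimately show ?thesis using that m by blast
qed

text \<open>The limit is the residue of \<open>- \<zeta>'/\<zeta>\<close> at \<open>s\<close>: the pole of \<open>\<zeta>\<close> at \<open>1\<close> counts \<open>1\<close>, a zero
  of order \<open>m\<close> counts \<open>- m\<close>.\<close>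

lemma mangoldt_series_radial_limit:
  assumes s: "Re s \<ge> 1"
  obtains m :: nat where "m > 0 \<longleftrightarrow> zeta_pole_free s = 0"
    "((\<lambda>e. of_real e * mangoldt_series (s + of_real e)) \<longlongrightarrow> (if s = 1 then 1 else 0) - of_nat m) (at_right 0)"
proof -
  have nonconst: "\<not> zeta_pole_free constant_on {s. Re s > 0}" if "zeta_pole_free s = 0"
  proof
    assume "zeta_pole_free constant_on {s. Re s > 0}"
    then obtain c where c: "\<And>w. Re w > 0 \<Longrightarrow> zeta_pole_free w = c" unfolding constant_on_def by auto
    from c[of s] c[of 1] that s show False by auto
  qed
  have halfplane: "open {s. Re s > 0}" "connected {s. Re s > 0}" "s \<in> {s. Re s > 0}"
    using s by (auto simp: open_halfspace_Re_gt intro!: convex_connected convex_halfspace_Re_gt)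
  obtain m :: nat where m: "m > 0 \<longleftrightarrow> zeta_pole_free s = 0"
    "\<forall>\<^sub>F e in at_right 0. zeta_pole_free (s + of_real e) \<noteq> 0"
    "((\<lambda>e. of_real e * deriv zeta_pole_free (s + of_real e) / zeta_pole_free (s + of_real e))
        \<longlongrightarrow> of_nat m) (at_right 0)"
    using log_deriv_radial_limit[OF zeta_pole_free_holomorphic halfplane nonconst] by blast
  have pole: "((\<lambda>e. of_real e / (s + of_real e - 1)) \<longlongrightarrow> (if s = 1 then 1 else 0)) (at_right 0)"
  proof (cases "s = 1")
    case True
    have "\<forall>\<^sub>F e in at_right 0. of_real e / (s + of_real e - 1) = 1"
      using eventually_at_right_real[of 0 1] by (auto elim!: eventually_mono simp: True)
    thus ?thesis using True by (simp add: tendsto_eventually)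
  next
    case False
    have "((\<lambda>e. of_real e / (s + of_real e - 1)) \<longlongrightarrow> of_real 0 / (s + of_real 0 - 1)) (at_right 0)"
      using False by (intro tendsto_intros) auto
    thus ?thesis using False by simp
  qed
  have "\<forall>\<^sub>F e in at_right 0. of_real e / (s + of_real e - 1)
      - of_real e * deriv zeta_pole_free (s + of_real e) / zeta_pole_free (s + of_real e)
      = of_real e * mangoldt_series (s + of_real e)"
    using m(2) eventually_at_right_less
  proof eventually_elim
    case (elim e)
    define w where "w = s + complex_of_real e"
    have w: "Re w > 1" "zeta_pole_free w \<noteq> 0" "w - 1 \<noteq> 0"
      using elim s by (auto simp: w_def complex_eq_iff)
    have "mangoldt_series w = 1 / (w - 1) - deriv zeta_pole_free w / zeta_pole_free w"
      using mangoldt_series_pole_free[OF w(1)] w(2,3) by (simp add: divide_simps)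
    thus ?case by (simp add: w_def [symmetric] right_diff_distrib)
  qed
  hence "((\<lambda>e. of_real e * mangoldt_series (s + of_real e)) \<longlongrightarrow> (if s
      = 1 then 1 else 0) - of_nat m) (at_right 0)"
    by (rule Lim_transform_eventually[rotated]) (intro tendsto_diff pole m(3))
  thus ?thesis using that m(1) by blast
qed

lemma Re_nat_power:
  "Re (nat_power (Complex x y) n) = real n powr (- x) * cos (y * ln (real n))"
  by (cases "n = 0") (auto simp: powr_def Ln_of_nat Re_exp)

text \<open>Termwise, from \<open>3 + 4 cos \<theta> + cos 2\<theta> = 2 (1 + cos \<theta>)\<^sup>2\<close>.\<close>

lemma mangoldt_3_4_1:
  assumes x: "x > 1"
  shows "0 \<le> 3 * Re (mangoldt_series (Complex x 0)) + 4 * Re (mangoldt_series (Complex x y))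
    + Re (mangoldt_series (Complex x (2 * y)))"
proof -
  have sums: "(\<lambda>n. mangoldt n * (real n powr (- x) * cos (z * ln (real n))))
      sums Re (mangoldt_series (Complex x z))" for z
  proof -
    have "(\<lambda>n. mangoldt n * nat_power (Complex x z) n) sums mangoldt_series (Complex x z)"
      unfolding mangoldt_series_def using x
      by (intro summable_sums summable_norm_cancel[OF summable_norm_mangoldt_series]) auto
    hence "(\<lambda>n. Re (of_real (mangoldt n) * nat_power (Complex x z) n))
        sums Re (mangoldt_series (Complex x z))"
      by (intro sums_Re) simp
    moreover have "Re (of_real r * w) = r * Re w" for r w by simp
    ultimately show ?thesis by (simp only: Re_nat_power)
  qed
  have total: "(\<lambda>n. 3 * (mangoldt n * (real n powr (- x) * cos (0 * ln (real n))))
      + 4 * (mangoldt n * (real n powr (- x) * cos (y * ln (real n))))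
      + mangoldt n * (real n powr (- x) * cos (2 * y * ln (real n))))
      sums (3 * Re (mangoldt_series (Complex x 0)) + 4 * Re (mangoldt_series (Complex x y))
        + Re (mangoldt_series (Complex x (2 * y))))" (is "?f sums _")
    by (intro sums_add sums_mult sums)
  have "?f n \<ge> 0" for n
  proof -
    define c where "c = cos (y * ln (real n))"
    have cos2: "cos (2 * y * ln (real n)) = 2 * c\<^sup>2 - 1"
      using cos_double_cos[of "y * ln (real n)"] by (simp add: c_def mult.assoc)
    have "?f n = 3 * (mangoldt n * real n powr (- x)) + 4 * (mangoldt n * (real n powr (- x) * c))
        + mangoldt n * (real n powr (- x) * (2 * c\<^sup>2 - 1))"
      unfolding cos2 c_def [symmetric] by simp
    also have "\<dots> = mangoldt n * real n powr (- x) * (2 * (1 + c)\<^sup>2)"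
      by (simp add: power2_eq_square algebra_simps)
    finally have "?f n = mangoldt n * real n powr (- x) * (2 * (1 + c)\<^sup>2)" .
    thus ?thesis by (simp add: mangoldt_nonneg)
  qed
  thus ?thesis by (rule sums_le[OF _ sums_zero total])
qed

text \<open>By absolute convergence the series of \<open>\<Lambda>\<close> is bounded to the right of \<open>s\<close>, so its
  residue, which is minus the order of vanishing, is \<open>0\<close>.\<close>

lemma zeta_pole_free_nonzero_right:
  assumes s: "Re s > 1" shows "zeta_pole_free s \<noteq> 0"
proof -
  obtain m :: nat where m: "m > 0 \<longleftrightarrow> zeta_pole_free s = 0"
    "((\<lambda>e. of_real e * mangoldt_series (s + of_real e)) \<longlongrightarrow> (if s = 1 then 1 else 0) - of_nat m) (at_right 0)"
    by (rule mangoldt_series_radial_limit[of s]) (use s in auto)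
  define B where "B = (\<Sum>n. norm (mangoldt n * nat_power s n))"
  have lim0: "((\<lambda>e. of_real e * mangoldt_series (s + of_real e)) \<longlongrightarrow> 0) (at_right 0)"
  proof (rule Lim_null_comparison)
    have "norm (of_real e * mangoldt_series (s + of_real e)) \<le> e * B" if "e > 0" for e
    proof -
      have "norm (mangoldt_series (s + of_real e)) \<le> B"
        unfolding mangoldt_series_def B_def
      proof (rule norm_suminf_le)
        show "norm (mangoldt n * nat_power (s + of_real e) n) \<le> norm (mangoldt n * nat_power s n)" for n
          unfolding norm_mult norm_nat_power using that
          by (cases "n = 0") (auto simp: mangoldt_nonneg intro!: mult_left_mono powr_mono)
      qed (rule summable_norm_mangoldt_series[OF s])
      thus ?thesis using that by (simp add: norm_mult)
    qed
    thus "\<forall>\<^sub>F e in at_right 0. norm (of_real e * mangoldt_series (s + of_real e)) \<le> e * B"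
      using eventually_at_right_less[of "0::real"] by (auto elim: eventually_mono)
    have "((\<lambda>e. e * B) \<longlongrightarrow> 0 * B) (at_right 0)" by (intro tendsto_intros)
    thus "((\<lambda>e. e * B) \<longlongrightarrow> 0) (at_right 0)" by simp
  qed
  have "- complex_of_nat m = 0"
    using tendsto_unique[OF trivial_limit_at_right_real m(2) lim0] s by (auto split: if_splits)
  thus ?thesis using m(1) by simp
qed

text \<open>Take residues in the inequality of \<open>mangoldt_3_4_1\<close>: zeros of orders \<open>m\<close> and \<open>k\<close> at
  \<open>1 + \<i> y\<close> and \<open>1 + 2 \<i> y\<close> give \<open>3 - 4 m - k \<ge> 0\<close>, which leaves only \<open>m = 0\<close>.\<close>

lemma zeta_pole_free_nonzero_line: "zeta_pole_free (Complex 1 y) \<noteq> 0"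
proof
  assume zero: "zeta_pole_free (Complex 1 y) = 0"
  have one: "Complex 1 0 = 1" by (simp add: complex_eq_iff)
  have y: "y \<noteq> 0" using zero by (auto simp: one)
  have lim: "\<exists>m::nat. (m > 0 \<longleftrightarrow> zeta_pole_free (Complex 1 z) = 0) \<and>
    ((\<lambda>e. e * Re (mangoldt_series (Complex (1 + e) z))) \<longlongrightarrow> (if z
        = 0 then 1 else 0) - real m) (at_right 0)" for z
  proof -
    obtain m :: nat where m: "m > 0 \<longleftrightarrow> zeta_pole_free (Complex 1 z) = 0"
      "((\<lambda>e. of_real e * mangoldt_series (Complex 1 z + of_real e)) \<longlongrightarrow>
        (if Complex 1 z = 1 then 1 else 0) - of_nat m) (at_right 0)"
      by (rule mangoldt_series_radial_limit[of "Complex 1 z"]) simp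
    have "((\<lambda>e. Re (of_real e * mangoldt_series (Complex 1 z + of_real e))) \<longlongrightarrow>
        Re ((if Complex 1 z = 1 then 1 else 0) - of_nat m)) (at_right 0)"
      by (intro tendsto_Re m(2))
    moreover have "Complex 1 z + of_real e = Complex (1 + e) z" for e by (simp add: complex_eq_iff)
    moreover have "Re ((if Complex 1 z = 1 then 1 else 0) - of_nat m) = (if z = 0 then 1 else 0) - real m"
      by (simp add: complex_eq_iff)
    ultimately show ?thesis using m(1) by (intro exI[of _ m]) simp
  qed
  from lim[of 0] obtain m0 :: nat where m0: "m0 > 0 \<longleftrightarrow> zeta_pole_free (Complex 1 0) = 0"
      "((\<lambda>e. e * Re (mangoldt_series (Complex (1 + e) 0))) \<longlongrightarrow> 1 - real m0) (at_right 0)"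
    unfolding simp_thms if_True by blast
  from lim[of y] y obtain m :: nat where m: "m > 0 \<longleftrightarrow> zeta_pole_free (Complex 1 y) = 0"
      "((\<lambda>e. e * Re (mangoldt_series (Complex (1 + e) y))) \<longlongrightarrow> 0 - real m) (at_right 0)"
    by (simp only: if_False) blast
  from lim[of "2 * y"] y obtain k :: nat
    where k: "((\<lambda>e. e * Re (mangoldt_series (Complex (1 + e) (2 * y)))) \<longlongrightarrow> 0 - real k) (at_right 0)"
    by (simp only: mult_eq_0_iff zero_neq_numeral [symmetric] simp_thms if_False) blast
  have "((\<lambda>e. 3 * (e * Re (mangoldt_series (Complex (1 + e) 0)))
      + 4 * (e * Re (mangoldt_series (Complex (1 + e) y)))
      + e * Re (mangoldt_series (Complex (1 + e) (2 * y))))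
      \<longlongrightarrow> 3 * (1 - real m0) + 4 * (0 - real m) + (0 - real k)) (at_right 0)"
    by (intro tendsto_intros m0 m k)
  moreover have "\<forall>\<^sub>F e in at_right 0. 0 \<le> 3 * (e * Re (mangoldt_series (Complex (1 + e) 0)))
      + 4 * (e * Re (mangoldt_series (Complex (1 + e) y))) + e * Re (mangoldt_series (Complex (1
          + e) (2 * y)))"
    using eventually_at_right_less[of "0::real"]
  proof eventually_elim
    case (elim e)
    hence "0 \<le> e * (3 * Re (mangoldt_series (Complex (1 + e) 0)) + 4 * Re (mangoldt_series (Complex (1
        + e) y))
      + Re (mangoldt_series (Complex (1 + e) (2 * y))))"
      by (intro mult_nonneg_nonneg mangoldt_3_4_1) auto
    thus ?case by (simp add: algebra_simps)
  qed
  ultimately have "0 \<le> 3 * (1 - real m0) + 4 * (0 - real m) + (0 - real k)"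
    by (intro tendsto_lowerbound[where F = "at_right (0::real)"]) auto
  moreover have "m0 = 0" using m0 by (simp add: one)
  moreover have "m \<ge> 1" using m zero by simp
  ultimately show False by simp
qed

theorem zeta_pole_free_nonzero:
  assumes "Re s \<ge> 1" shows "zeta_pole_free s \<noteq> 0"
proof (cases "Re s = 1")
  case True
  hence "s = Complex 1 (Im s)" by (simp add: complex_eq_iff)
  thus ?thesis using zeta_pole_free_nonzero_line by metis
qed (use assms zeta_pole_free_nonzero_right in auto)

section \<open>The prime number theorem\<close>

text \<open>For positive \<open>k\<close>, the integral of \<open>(\<psi>(k) - x) / x\<^sup>2\<close> over \<open>[k, k + 1]\<close>.\<close>

definition psi_cell :: "nat \<Rightarrow> real" where
  "psi_cell k = chebyshev_psi k * (1 / real k - 1 / real (Suc k)) - (ln (real (Suc k)) - ln (real k))"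

lemma mellin_cell_psi_at_1:
  assumes "k > 0" shows "mellin_cell k (chebyshev_psi k) 1 = of_real (psi_cell k)"
proof -
  define c where "c = chebyshev_psi k"
  define G where "G = (\<lambda>z. - of_real c / z - Ln z)"
  have "((\<lambda>x. of_real (c - x) * of_real x powr (- 1 - 1)) has_integral
      (G (of_real (real k + 1)) - G (of_real (real k)))) {real k..real k + 1}"
  proof (rule fundamental_theorem_of_calculus)
    fix x assume x: "x \<in> {real k..real k + 1}"
    hence x0: "x > 0" using assms by auto
    have "(G has_field_derivative (of_real c / (of_real x * of_real x) - 1 / of_real x)) (at (of_real x))"
      unfolding G_def using x0
      by (auto intro!: derivative_eq_intros simp: complex_nonpos_Reals_iff inverse_eq_divide)
    also have "of_real c / (of_real x * of_real x) - 1 / of_real x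
        = of_real (c - x) * (of_real x :: complex) powr (- 1 - 1)"
      using x0 by (simp add: powr_minus powr_numeral power2_eq_square divide_simps)
    finally show "((\<lambda>x. G (of_real x)) has_vector_derivative (of_real (c - x) * of_real x powr (- 1 - 1)))
        (at x within {real k..real k + 1})"
      by (rule has_vector_derivative_real_field)
  qed auto
  hence "mellin_cell k c 1 = G (of_real (real k + 1)) - G (of_real (real k))"
    using mellin_cell_has_integral[OF assms] has_integral_unique by blast
  also have "\<dots> = of_real (psi_cell k)"
    using assms Ln_of_real[of "real k + 1"] Ln_of_real[of "real k"]
    by (simp add: G_def psi_cell_def c_def algebra_simps)
  finally show ?thesis by (simp add: c_def)
qed

text \<open>Newman's theorem, applied in the variable \<open>z = s - 1\<close>. With \<open>Z(s) = (s - 1) \<zeta>(s)\<close> the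
  poles of the series of \<open>\<Lambda>\<close> and of \<open>1 / (s - 1)\<close> cancel, and the limit function is
  \<open>- (1 + Z'(s) / Z(s)) / s\<close>.\<close>

theorem summable_psi_cell: "summable psi_cell"
proof -
  define Z where "Z = zeta_pole_free"
  define F where "F = (\<lambda>z. - (1 + deriv Z (1 + z) / Z (1 + z)) / (1 + z))"
  define U where "U = {z. Re z > - 1} \<inter> {z. Z (1 + z) \<noteq> 0}"
  define V where "V = {z. Re z > - 1}"
  have V: "open V" by (simp add: V_def open_halfspace_Re_gt)
  have Z_hol: "Z holomorphic_on {s. Re s > 0}" unfolding Z_def by (rule zeta_pole_free_holomorphic)
  have Z'_hol: "deriv Z holomorphic_on {s. Re s > 0}"
    by (intro holomorphic_deriv Z_hol open_halfspace_Re_gt)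
  have shift: "(\<lambda>z. f (1 + z)) holomorphic_on V" if "f holomorphic_on {s. Re s > 0}" for f
  proof -
    have "f \<circ> (\<lambda>z. 1 + z) holomorphic_on V"
      using that by (rule holomorphic_on_compose_gen[rotated]) (auto simp: V_def intro!: holomorphic_intros)
    thus ?thesis by (simp add: o_def)
  qed
  have "(\<lambda>n. mellin_cell (Suc n) (chebyshev_psi (Suc n)) (1 + 0)) sums F 0"
  proof (rule newman_tauberian[where C = 6 and U = U])
    fix n
    have "mellin_cell (Suc n) (chebyshev_psi (Suc n)) \<circ> (\<lambda>z. 1 + z) holomorphic_on UNIV"
      by (intro holomorphic_on_compose_gen[OF _ mellin_cell_holomorphic]) (auto intro!: holomorphic_intros)
    thus "(\<lambda>z. mellin_cell (Suc n) (chebyshev_psi (Suc n)) (1 + z)) holomorphic_on UNIV"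
      by (simp add: o_def)
  next
    fix n and z :: complex assume z: "Re z \<noteq> 0"
    have "norm (mellin_cell (Suc n) (chebyshev_psi (Suc n)) (1 + z))
      \<le> 6 * ((real (Suc n) powr (1 - Re (1 + z)) - real (Suc (Suc n)) powr (1 - Re (1 + z))) / (Re (1
          + z) - 1))"
    proof (rule norm_mellin_cell_linear_bound)
      fix x assume "x \<in> {real (Suc n)..real (Suc n) + 1}"
      thus "\<bar>chebyshev_psi (Suc n) - x\<bar> \<le> 6 * x"
        using chebyshev_psi_le[of "Suc n"] chebyshev_psi_nonneg[of "Suc n"] by auto
    qed (use z in auto)
    thus "norm (mellin_cell (Suc n) (chebyshev_psi (Suc n)) (1 + z))
      \<le> 6 * ((real (Suc n) powr (- Re z) - real (Suc (Suc n)) powr (- Re z)) / Re z)" by simp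
  next
    have "open (V \<inter> (\<lambda>z. Z (1 + z)) -` (- {0}))"
      using V shift[OF Z_hol] by (intro continuous_open_preimage holomorphic_on_imp_continuous_on) auto
    also have "V \<inter> (\<lambda>z. Z (1 + z)) -` (- {0}) = U" by (auto simp: U_def V_def)
    finally show "open U" .
    show "{z. Re z \<ge> 0} \<subseteq> U" using zeta_pole_free_nonzero by (auto simp: U_def Z_def)
    show "F holomorphic_on U"
      unfolding F_def
    proof (intro holomorphic_intros)
      show "(\<lambda>z. deriv Z (1 + z)) holomorphic_on U" "(\<lambda>z. Z (1 + z)) holomorphic_on U"
        using shift[OF Z_hol] shift[OF Z'_hol] by (auto intro: holomorphic_on_subset simp: U_def V_def)
    qed (auto simp: U_def complex_eq_iff)
  next
    fix z :: complex assume z: "Re z > 0"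
    define s where "s = 1 + z"
    have s: "Re s > 1" using z by (simp add: s_def)
    have s': "s \<noteq> 0" "s - 1 \<noteq> 0" "Z s \<noteq> 0"
      using s zeta_pole_free_nonzero[of s] by (auto simp: Z_def)
    have "mangoldt_series s = 1 / (s - 1) - deriv Z s / Z s"
      using mangoldt_series_pole_free[OF s] s' by (simp add: divide_simps Z_def)
    hence "mangoldt_series s / s - 1 / (s - 1) = F z"
      using s' unfolding F_def s_def [symmetric] by (simp add: divide_simps) (simp add: algebra_simps)
    thus "(\<lambda>n. mellin_cell (Suc n) (chebyshev_psi (Suc n)) (1 + z)) sums F z"
      using mangoldt_cells_sum[OF s] by (simp add: s_def)
  qed auto
  hence "(\<lambda>n. complex_of_real (psi_cell (Suc n))) sums F 0" by (simp add: mellin_cell_psi_at_1)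
  hence "summable (\<lambda>n. of_real (psi_cell (Suc n)) :: complex)" by (rule sums_summable)
  hence "summable (\<lambda>n. psi_cell (Suc n))" by (simp only: summable_of_real_iff)
  thus ?thesis by (simp add: summable_Suc_iff)
qed

lemma sum_constant_cells:
  assumes "0 < n" "n \<le> m"
  shows "(\<Sum>k=n..<m. c * (1 / real k - 1 / real (Suc k)) - (ln (real (Suc k)) - ln (real k)))
    = c * (1 / real n - 1 / real m) - (ln (real m) - ln (real n))"
  using assms(2)
proof (induction m rule: dec_induct)
  case (step k) thus ?case using assms(1) by (simp add: algebra_simps)
qed (simp add: algebra_simps)

text \<open>Both parts are \<open>ln x \<le> x - 1\<close>, for \<open>x = m / n\<close> and for \<open>x = n / m\<close>. They bound a block
  of cells with constant \<open>\<psi>\<close> by a rational expression whose sign is visible.\<close>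

lemma log_ratio_bound:
  fixes n m c :: real
  assumes "0 < n" "0 < m"
  shows "(m - n) * (c * n - m) / (m * n) \<le> c * n * (1 / n - 1 / m) - (ln m - ln n)"
    "c * m * (1 / n - 1 / m) - (ln m - ln n) \<le> (m - n) * (c * m - n) / (m * n)"
proof -
  have "ln m - ln n \<le> m / n - 1"
    using ln_le_minus_one[of "m / n"] assms by (simp add: ln_div)
  moreover have "c * n * (1 / n - 1 / m) - (m / n - 1) = (m - n) * (c * n - m) / (m * n)"
    using assms by (simp add: field_simps)
  ultimately show "(m - n) * (c * n - m) / (m * n) \<le> c * n * (1 / n - 1 / m) - (ln m - ln n)" by linarith
  have "ln n - ln m \<le> n / m - 1"
    using ln_le_minus_one[of "n / m"] assms by (simp add: ln_div)
  moreover have "c * m * (1 / n - 1 / m) - (1 - n / m) = (m - n) * (c * m - n) / (m * n)"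
    using assms by (simp add: field_simps)
  ultimately show "c * m * (1 / n - 1 / m) - (ln m - ln n) \<le> (m - n) * (c * m - n) / (m * n)" by linarith
qed

lemma psi_cell_block_small:
  assumes "e > 0"
  shows "\<exists>N. \<forall>n\<ge>N. \<forall>m. \<bar>\<Sum>k=n..<m. psi_cell k\<bar> < e"
  using summable_psi_cell assms unfolding summable_Cauchy real_norm_def by blast

text \<open>If \<open>\<psi>(n) \<ge> l n\<close>, then \<open>\<psi> \<ge> l n\<close> on the whole of \<open>[n, \<mu> n]\<close> by monotonicity, where
  \<open>1 < \<mu> < l\<close>. The cells over this block add up to at least a positive constant, which a
  convergent series permits only for small \<open>n\<close>.\<close>

lemma chebyshev_psi_eventually_less:
  assumes l: "l > 1"
  shows "\<forall>\<^sub>F n in sequentially. chebyshev_psi n < l * real n"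
proof -
  define \<mu> where "\<mu> = (1 + l) / 2"
  have \<mu>: "1 < \<mu>" "\<mu> < l" using l by (auto simp: \<mu>_def)
  define e where "e = (\<mu> - 1) * ((l - \<mu>) / 2) / l"
  have "e > 0" using \<mu> by (simp add: e_def)
  then obtain N where N: "\<And>n m. n \<ge> N \<Longrightarrow> \<bar>\<Sum>k=n..<m. psi_cell k\<bar> < e"
    using psi_cell_block_small by blast
  have "chebyshev_psi n < l * real n" if n: "n \<ge> max N (nat \<lceil>2 / (l - \<mu>)\<rceil> + 1)" for n
  proof (rule ccontr)
    assume "\<not> ?thesis"
    hence large: "l * real n \<le> chebyshev_psi n" by simp
    have n0: "n > 0" using n by simp
    have "2 / (l - \<mu>) \<le> real n" using n by linarith
    hence n2: "1 \<le> (l - \<mu>) / 2 * real n" using \<mu> by (simp add: field_simps)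
    \<comment> \<open>the block of cells runs over \<open>[n, m)\<close>; the condition on \<open>n\<close> makes the rounding of \<open>m\<close> harmless\<close>
    define m where "m = nat \<lceil>\<mu> * real n\<rceil>"
    have "\<mu> * real n > 0" using \<mu> n0 by simp
    hence m: "\<mu> * real n \<le> real m" "real m \<le> \<mu> * real n + 1" unfolding m_def by linarith+
    have "1 * real n \<le> \<mu> * real n" using \<mu> by (intro mult_right_mono) auto
    hence nm: "n \<le> m" using m by linarith
    have "l * real n = \<mu> * real n + 2 * ((l - \<mu>) / 2 * real n)" by (simp add: field_simps)
    hence m_le: "l * real n - real m \<ge> (l - \<mu>) / 2 * real n" using m n2 by linarith
    have "0 \<le> (l - \<mu>) / 2 * real n" using \<mu> by simp
    hence m_le': "real m \<le> l * real n" using m_le by linarith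
    have "e = ((\<mu> - 1) * real n) * ((l - \<mu>) / 2 * real n) / (l * real n * real n)"
      using n0 l by (simp add: e_def divide_simps)
    also have "\<dots> \<le> (real m - real n) * (l * real n - real m) / (real m * real n)"
      using m_le m_le' m \<mu> n0 nm l
      by (intro frac_le mult_mono mult_nonneg_nonneg) (auto simp: left_diff_distrib)
    also have "\<dots> \<le> l * real n * (1 / real n - 1 / real m) - (ln (real m) - ln (real n))"
      using n0 nm by (intro log_ratio_bound) auto
    also have "\<dots> = (\<Sum>k=n..<m. l * real n * (1 / real k - 1 / real (Suc k)) - (ln (real (Suc k)) - ln
        (real k)))"
      using sum_constant_cells[OF n0 nm] by simp
    also have "\<dots> \<le> (\<Sum>k=n..<m. psi_cell k)"
    proof (rule sum_mono)
      fix k assume k: "k \<in> {n..<m}"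
      hence "l * real n \<le> chebyshev_psi k" using large chebyshev_psi_mono[of n k] by simp
      moreover have "0 \<le> 1 / real k - 1 / real (Suc k)" using k n0 by (simp add: field_simps)
      ultimately show "l * real n * (1 / real k - 1 / real (Suc k)) - (ln (real (Suc k)) - ln (real k))
          \<le> psi_cell k"
        unfolding psi_cell_def by (intro diff_right_mono mult_right_mono)
    qed
    finally show False using N[of n m] n by simp
  qed
  thus ?thesis unfolding eventually_sequentially by blast
qed

text \<open>The mirror image: \<open>\<psi>(n) \<le> l n\<close> with \<open>l < 1\<close> makes the cells over \<open>[\<mu> n, n]\<close>, where
  \<open>l < \<mu> < 1\<close>, add up to at most a negative constant.\<close>

lemma chebyshev_psi_eventually_greater:
  assumes l: "0 < l" "l < 1"
  shows "\<forall>\<^sub>F n in sequentially. l * real n < chebyshev_psi n"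
proof -
  define \<mu> where "\<mu> = (1 + l) / 2"
  have \<mu>: "l < \<mu>" "\<mu> < 1" "\<mu> > 0" using l by (auto simp: \<mu>_def)
  define e where "e = (1 - \<mu>) / 2 * (\<mu> - l)"
  have "e > 0" using \<mu> by (simp add: e_def)
  then obtain N where N: "\<And>n m. n \<ge> N \<Longrightarrow> \<bar>\<Sum>k=n..<m. psi_cell k\<bar> < e"
    using psi_cell_block_small by blast
  have "l * real n < chebyshev_psi n" if n: "n \<ge> nat \<lceil>2 / (1 - \<mu>)\<rceil> + nat \<lceil>real N / \<mu>\<rceil> + 1" for n
  proof (rule ccontr)
    assume "\<not> ?thesis"
    hence small: "chebyshev_psi n \<le> l * real n" by simp
    have n0: "n > 0" using n by simp
    have "2 / (1 - \<mu>) \<le> real n" using n by linarith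
    hence n2: "1 \<le> (1 - \<mu>) / 2 * real n" using \<mu> by (simp add: field_simps)
    have "real N / \<mu> \<le> real n" using n by linarith
    hence nN: "real N \<le> \<mu> * real n" using \<mu> by (simp add: field_simps)
    define m where "m = nat \<lceil>\<mu> * real n\<rceil>"
    have \<mu>n: "\<mu> * real n > 0" using \<mu> n0 by simp
    hence m: "\<mu> * real n \<le> real m" "real m \<le> \<mu> * real n + 1" unfolding m_def by linarith+
    have m0: "m > 0" using m \<mu>n by linarith
    have "real n = \<mu> * real n + 2 * ((1 - \<mu>) / 2 * real n)" by (simp add: field_simps)
    hence nm: "real n - real m \<ge> (1 - \<mu>) / 2 * real n" using m n2 by linarith
    moreover have "0 \<le> (1 - \<mu>) / 2 * real n" using \<mu> by simp
    ultimately have mn: "m \<le> n" by linarith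
    have m_gt: "l * real n \<le> real m" using m(1) mult_right_mono[of l \<mu> "real n"] \<mu> by simp
    have "(\<Sum>k=m..<n. psi_cell k)
      \<le> (\<Sum>k=m..<n. l * real n * (1 / real k - 1 / real (Suc k)) - (ln (real (Suc k)) - ln (real k)))"
    proof (rule sum_mono)
      fix k assume k: "k \<in> {m..<n}"
      hence "chebyshev_psi k \<le> l * real n" using small chebyshev_psi_mono[of k n] by simp
      moreover have "0 \<le> 1 / real k - 1 / real (Suc k)" using k m0 by (simp add: field_simps)
      ultimately show "psi_cell k
          \<le> l * real n * (1 / real k - 1 / real (Suc k)) - (ln (real (Suc k)) - ln (real k))"
        unfolding psi_cell_def by (intro diff_right_mono mult_right_mono)
    qed
    also have "\<dots> = l * real n * (1 / real m - 1 / real n) - (ln (real n) - ln (real m))"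
      using sum_constant_cells[OF m0 mn] by simp
    also have "\<dots> \<le> (real n - real m) * (l * real n - real m) / (real n * real m)"
      using n0 m0 by (intro log_ratio_bound) auto
    also have "\<dots> = - ((real n - real m) * (real m - l * real n) / (real n * real m))"
      by (metis minus_diff_eq mult_minus_right minus_divide_left)
    finally have "(real n - real m) * (real m - l * real n) / (real n * real m) \<le> - (\<Sum>k=m..<n. psi_cell k)"
      by linarith
    moreover have "e = ((1 - \<mu>) / 2 * real n) * ((\<mu> - l) * real n) / (real n * real n)"
      using n0 by (simp add: e_def)
    moreover have "\<dots> \<le> (real n - real m) * (real m - l * real n) / (real n * real m)"
      using nm m \<mu> n0 m0 mn m_gt
      by (intro frac_le mult_mono mult_nonneg_nonneg) (auto simp: left_diff_distrib)
    moreover have "m \<ge> N" using m nN by linarith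
    ultimately show False using N[of m n] by simp
  qed
  thus ?thesis unfolding eventually_sequentially by blast
qed

theorem prime_number_theorem: "(\<lambda>n. chebyshev_psi n / real n) \<longlonglongrightarrow> 1"
proof (rule order_tendstoI)
  fix a :: real assume a: "a < 1"
  define l where "l = max a (1 / 2)"
  have "\<forall>\<^sub>F n in sequentially. l * real n < chebyshev_psi n"
    using a by (intro chebyshev_psi_eventually_greater) (auto simp: l_def)
  thus "\<forall>\<^sub>F n in sequentially. a < chebyshev_psi n / real n"
    using eventually_gt_at_top[of 0]
  proof eventually_elim
    case (elim n)
    hence "l < chebyshev_psi n / real n" by (simp add: field_simps)
    thus ?case by (simp add: l_def)
  qed
next
  fix b :: real assume "1 < b"
  from chebyshev_psi_eventually_less[OF this]
  show "\<forall>\<^sub>F n in sequentially. chebyshev_psi n / real n < b"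
    using eventually_gt_at_top[of 0] by eventually_elim (simp add: field_simps)
qed

section \<open>The mass of the prime comb\<close>

lemma stolz_cesaro:
  fixes x d :: "nat \<Rightarrow> real"
  assumes d: "\<And>n. d n > 0" and D: "filterlim (\<lambda>N. \<Sum>n<N. d n) at_top sequentially"
    and lim: "(\<lambda>n. x n / d n) \<longlonglongrightarrow> L"
  shows "(\<lambda>N. (\<Sum>n<N. x n) / (\<Sum>n<N. d n)) \<longlonglongrightarrow> L"
proof (rule LIMSEQ_I)
  fix e :: real assume e: "e > 0"
  obtain N0 where N0: "\<And>n. n \<ge> N0 \<Longrightarrow> \<bar>x n / d n - L\<bar> < e / 2"
    using LIMSEQ_D[OF lim, of "e / 2"] e by auto
  have N0': "\<bar>x n - L * d n\<bar> \<le> e / 2 * d n" if "n \<ge> N0" for n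
  proof -
    have "x n - L * d n = (x n / d n - L) * d n" using d[of n] by (simp add: field_simps)
    thus ?thesis using N0[OF that] d[of n] by (simp add: abs_mult)
  qed
  define C where "C = (\<Sum>n<N0. \<bar>x n - L * d n\<bar>)"
  have "\<forall>\<^sub>F N in sequentially. (\<Sum>n<N. d n) > max 0 (2 * C / e)"
    using D unfolding filterlim_at_top_dense by blast
  then obtain N1 where N1: "\<And>N. N \<ge> N1 \<Longrightarrow> (\<Sum>n<N. d n) > max 0 (2 * C / e)"
    unfolding eventually_sequentially by blast
  show "\<exists>no. \<forall>N\<ge>no. norm ((\<Sum>n<N. x n) / (\<Sum>n<N. d n) - L) < e"
  proof (intro exI allI impI)
    fix N assume N: "N \<ge> max N0 N1"
    define S where "S = (\<Sum>n<N. d n)"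
    have S: "S > 0" "2 * C / e < S" using N1[of N] N by (auto simp: S_def)
    have "\<bar>(\<Sum>n<N. x n) - L * S\<bar> = \<bar>\<Sum>n<N. x n - L * d n\<bar>"
      by (simp add: S_def sum_subtractf sum_distrib_left)
    also have "\<dots> \<le> (\<Sum>n<N. \<bar>x n - L * d n\<bar>)" by (rule sum_abs)
    also have "\<dots> = C + (\<Sum>n=N0..<N. \<bar>x n - L * d n\<bar>)"
      unfolding C_def lessThan_atLeast0 using N by (subst sum.atLeastLessThan_concat) auto
    also have "(\<Sum>n=N0..<N. \<bar>x n - L * d n\<bar>) \<le> (\<Sum>n=N0..<N. e / 2 * d n)"
      by (intro sum_mono N0') auto
    also have "\<dots> = e / 2 * (\<Sum>n=N0..<N. d n)" by (rule sum_distrib_left [symmetric])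
    also have "\<dots> \<le> e / 2 * S"
      unfolding S_def using e less_imp_le[OF d] by (intro mult_left_mono sum_mono2) auto
    also have "C < e / 2 * S" using S(2) e by (simp add: field_simps)
    finally have "\<bar>(\<Sum>n<N. x n) - L * S\<bar> < e * S" by (simp add: mult.commute)
    moreover have "(\<Sum>n<N. x n) / S - L = ((\<Sum>n<N. x n) - L * S) / S" using S by (simp add: field_simps)
    ultimately show "norm ((\<Sum>n<N. x n) / (\<Sum>n<N. d n) - L) < e"
      using S unfolding S_def [symmetric] by (simp add: field_simps)
  qed
qed

text \<open>Partial summation against \<open>1 / \<surd>k\<close>. The terms \<open>\<psi>(k) (1 / \<surd>k - 1 / \<surd>(k + 1))\<close> are
  asymptotic to \<open>\<surd>k - \<surd>(k - 1)\<close>, so by Stolz-Cesaro they contribute \<open>1\<close> to the limit, and the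
  boundary term contributes the other \<open>1\<close>.\<close>

theorem mangoldt_sqrt_sum_asymptotics:
  "(\<lambda>N. (\<Sum>k=1..N. mangoldt k / sqrt (real k)) / sqrt (real N)) \<longlonglongrightarrow> 2"
proof -
  define p where "p = (\<lambda>k. 1 / sqrt (real k))"
  define d where "d = (\<lambda>n. sqrt (real (Suc n)) - sqrt (real n))"
  define x where "x = (\<lambda>n. chebyshev_psi (Suc n) * (p (Suc n) - p (Suc (Suc n))))"
  have sum_d: "(\<Sum>n<N. d n) = sqrt (real N)" for N
    unfolding d_def using sum_lessThan_telescope[of "\<lambda>n. sqrt (real n)" N] by simp
  have "(\<lambda>N. (\<Sum>n<N. x n) / (\<Sum>n<N. d n)) \<longlonglongrightarrow> 1"
  proof (rule stolz_cesaro)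
    show "d n > 0" for n by (simp add: d_def)
    show "filterlim (\<lambda>N. \<Sum>n<N. d n) at_top sequentially"
      unfolding sum_d by real_asymp
    have "(\<lambda>n. chebyshev_psi (Suc n) / real (Suc n)) \<longlonglongrightarrow> 1"
      using prime_number_theorem by (rule filterlim_compose[OF _ filterlim_Suc])
    moreover have "(\<lambda>n. real (Suc n) * (p (Suc n) - p (Suc (Suc n))) / d n) \<longlonglongrightarrow> 1"
      unfolding p_def d_def by real_asymp
    ultimately have "(\<lambda>n. chebyshev_psi (Suc n) / real (Suc n) * (real (Suc n) * (p (Suc n) - p (Suc
        (Suc n))) / d n))
        \<longlonglongrightarrow> 1 * 1" by (rule tendsto_mult)
    thus "(\<lambda>n. x n / d n) \<longlonglongrightarrow> 1" by (simp add: x_def)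
  qed
  hence lim1: "(\<lambda>N. (\<Sum>n<N. x n) / sqrt (real N)) \<longlonglongrightarrow> 1" by (simp add: sum_d)
  have "(\<lambda>N. real N * p (Suc N) / sqrt (real N)) \<longlonglongrightarrow> 1"
    unfolding p_def by real_asymp
  from tendsto_mult[OF prime_number_theorem this]
  have lim2: "(\<lambda>N. chebyshev_psi N / real N * (real N * p (Suc N) / sqrt (real N))) \<longlonglongrightarrow> 1" by simp
  have "(\<lambda>N. (\<Sum>n<N. x n) / sqrt (real N) + chebyshev_psi N / real N * (real N * p (Suc N) / sqrt (real N)))
      \<longlonglongrightarrow> 1 + 1"
    by (intro tendsto_add lim1 lim2)
  moreover have "(\<Sum>n<N. x n) / sqrt (real N)
      + chebyshev_psi N / real N * (real N * p (Suc N) / sqrt (real N))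
      = (\<Sum>k=1..N. mangoldt k / sqrt (real k)) / sqrt (real N)" for N
  proof -
    have "(\<Sum>n<N. x n) = (\<Sum>n<N. mangoldt (Suc n) * p (Suc n)) - chebyshev_psi N * p (Suc N)"
      using partial_summation_identity[of "mangoldt :: nat \<Rightarrow> real" p N]
      by (simp add: x_def chebyshev_psi_def)
    also have "(\<Sum>n<N. mangoldt (Suc n) * p (Suc n)) = (\<Sum>k=1..N. mangoldt k / sqrt (real k))"
      by (simp add: p_def sum.atLeast1_atMost_eq)
    finally show ?thesis by (cases "N = 0") (simp_all add: diff_divide_distrib)
  qed
  ultimately show ?thesis by simp
qed

text \<open>The largest integer below \<open>e\<^bsup>2L\<^esup>\<close> is \<open>\<lceil>e\<^bsup>2L\<^esup>\<rceil> - 1\<close>; the term at \<open>1\<close> may be added because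
  \<open>\<Lambda>(1) = 0\<close>.\<close>

lemma comb_mass_eq:
  assumes "L > 0"
  shows "comb_mass L = 2 * (\<Sum>k=1..nat (\<lceil>exp (2 * L)\<rceil> - 1). mangoldt k / sqrt (real k))"
proof -
  have "{n. 2 \<le> n \<and> ln (real n) < 2 * L} = {1..nat (\<lceil>exp (2 * L)\<rceil> - 1)} - {1}"
  proof -
    have "ln (real n) < 2 * L \<longleftrightarrow> n \<le> nat (\<lceil>exp (2 * L)\<rceil> - 1)" if "n \<ge> 1" for n
    proof -
      have "ln (real n) < 2 * L \<longleftrightarrow> real n < exp (2 * L)"
        using that by (metis exp_less_cancel_iff exp_ln of_nat_0_less_iff less_eq_Suc_le One_nat_def)
      also have "\<dots> \<longleftrightarrow> int n < \<lceil>exp (2 * L)\<rceil>" by linarith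
      finally show ?thesis using that by linarith
    qed
    thus ?thesis by auto
  qed
  hence "comb_mass L = (\<Sum>n\<in>{1..nat (\<lceil>exp (2 * L)\<rceil> - 1)} - {1}. 2 * mangoldt n / sqrt (real n))"
    by (simp add: comb_mass_def)
  also have "\<dots> = (\<Sum>n=1..nat (\<lceil>exp (2 * L)\<rceil> - 1). 2 * mangoldt n / sqrt (real n))"
    by (rule sum.mono_neutral_left) auto
  finally show ?thesis by (simp add: sum_distrib_left)
qed

theorem comb_mass_asymptotics: "((\<lambda>L. comb_mass L / exp L) \<longlongrightarrow> 4) at_top"
proof -
  define N where "N L = nat (\<lceil>exp (2 * L)\<rceil> - 1)" for L :: real
  have N: "exp (2 * L) - 1 \<le> real (N L)" "real (N L) \<le> exp (2 * L)" for L
    using exp_gt_zero[of "2 * L"] unfolding N_def by linarith+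
  have "filterlim (\<lambda>L. real (N L)) at_top at_top"
  proof (rule filterlim_at_top_mono)
    show "filterlim (\<lambda>L::real. exp (2 * L) - 1) at_top at_top" by real_asymp
  qed (use N in simp)
  hence N_top: "filterlim N sequentially at_top"
    unfolding filterlim_at_top by (metis (mono_tags, lifting) eventually_mono of_nat_le_iff)
  have "((\<lambda>L. real (N L) / exp (2 * L)) \<longlongrightarrow> 1) at_top"
  proof (rule tendsto_sandwich)
    show "((\<lambda>L::real. (exp (2 * L) - 1) / exp (2 * L)) \<longlongrightarrow> 1) at_top" by real_asymp
    show "\<forall>\<^sub>F L in at_top. (exp (2 * L) - 1) / exp (2 * L) \<le> real (N L) / exp (2 * L)"
      using N by (intro always_eventually allI divide_right_mono) auto
    show "\<forall>\<^sub>F L in at_top. real (N L) / exp (2 * L) \<le> 1"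
      using N by (intro always_eventually allI) simp
  qed auto
  hence "((\<lambda>L. sqrt (real (N L) / exp (2 * L))) \<longlongrightarrow> sqrt 1) at_top" by (rule tendsto_real_sqrt)
  also have "(\<lambda>L. sqrt (real (N L) / exp (2 * L))) = (\<lambda>L. sqrt (real (N L)) / exp L)"
    by (simp add: fun_eq_iff real_sqrt_divide exp_double)
  finally have lim1: "((\<lambda>L. sqrt (real (N L)) / exp L) \<longlongrightarrow> 1) at_top" by simp
  have lim2: "((\<lambda>L. (\<Sum>k=1..N L. mangoldt k / sqrt (real k)) / sqrt (real (N L))) \<longlongrightarrow> 2) at_top"
    by (rule filterlim_compose[OF mangoldt_sqrt_sum_asymptotics N_top])
  have "((\<lambda>L. 2 * ((\<Sum>k=1..N L. mangoldt k / sqrt (real k)) / sqrt (real (N L)) * (sqrt (real (N L)) /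
      exp L)))
      \<longlongrightarrow> 2 * (2 * 1)) at_top"
    by (intro tendsto_mult tendsto_const lim1 lim2)
  moreover have "\<forall>\<^sub>F L in at_top. 2 * ((\<Sum>k=1..N L. mangoldt k / sqrt (real k)) / sqrt (real (N L)) *
      (sqrt (real (N L)) / exp L))
      = comb_mass L / exp L"
    using eventually_gt_at_top[of 0]
  proof eventually_elim
    case (elim L)
    show ?case by (cases "N L = 0") (simp_all add: comb_mass_eq[OF elim] flip: N_def)
  qed
  ultimately show ?thesis by (simp add: Lim_transform_eventually)
qed

section \<open>Quadrature nodes and roots of Legendre polynomials\<close>

text \<open>Each differentiation lowers the multiplicity of the factor \<open>p\<close> by at most one.\<close>

lemma power_dvd_pderiv_funpow:
  fixes p :: "real poly"
  shows "j \<le> n \<Longrightarrow> p ^ (n - j) dvd (pderiv ^^ j) (p ^ n)"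
proof (induction j)
  case (Suc j)
  define k where "k = n - Suc j"
  have "n - j = Suc k" using Suc.prems by (simp add: k_def)
  then obtain r where r: "(pderiv ^^ j) (p ^ n) = p ^ Suc k * r"
    using Suc by (auto elim!: dvdE)
  have "p ^ k dvd pderiv (p ^ Suc k * r)"
    unfolding pderiv_mult pderiv_power_Suc by (intro dvd_add) (simp_all add: dvd_smult)
  thus ?case by (simp add: r k_def)
qed simp

lemma degree_pderiv_funpow: "degree ((pderiv ^^ j) (p :: real poly)) = degree p - j"
  by (induction j) (simp_all add: degree_pderiv)

lemma legendre_poly_nonzero: "legendre_poly n \<noteq> 0"
proof -
  have "degree ([:- 1, 0, 1:] ^ n :: real poly) = 2 * n" by (simp add: degree_power_eq)
  hence deg: "degree ((pderiv ^^ n) ([:- 1, 0, 1:] ^ n :: real poly)) = n"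
    by (simp add: degree_pderiv_funpow)
  show ?thesis
  proof (cases "n = 0")
    case False
    thus ?thesis using deg by (auto simp: legendre_poly_def)
  qed (simp add: legendre_poly_def)
qed

text \<open>Rolle's theorem in the formula of Rodrigues: the derivative of order \<open>n - 1\<close> of
  \<open>(x\<^sup>2 - 1)\<^sup>n\<close> still vanishes at \<open>\<plusminus> 1\<close>.\<close>

lemma legendre_poly_root_exists:
  assumes "n \<ge> 1" obtains x where "- 1 < x" "x < 1" "poly (legendre_poly n) x = 0"
proof -
  define Q where "Q = (pderiv ^^ (n - 1)) ([:- 1, 0, 1:] ^ n :: real poly)"
  have "[:- 1, 0, 1:] ^ (n - (n - 1)) dvd Q"
    unfolding Q_def by (rule power_dvd_pderiv_funpow) simp
  hence "[:- 1, 0, 1:] dvd Q" using assms by simp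
  then obtain r where "Q = [:- 1, 0, 1:] * r" by (elim dvdE)
  hence "poly Q 1 = 0" "poly Q (- 1) = 0" by simp_all
  then obtain x where x: "- 1 < x" "x < 1" "poly (pderiv Q) x = 0"
    using poly_MVT[of "- 1" 1 Q] by auto
  have "pderiv Q = (pderiv ^^ n) ([:- 1, 0, 1:] ^ n)"
    using assms unfolding Q_def by (cases n) simp_all
  with x that show ?thesis by (simp add: legendre_poly_def)
qed

lemma finite_quadrature_nodes: "finite (quadrature_nodes q w T)"
  unfolding quadrature_nodes_def using poly_roots_finite[OF legendre_poly_nonzero[of q]] by auto

lemma card_quadrature_nodes_le:
  assumes "w > 0" "T > 0"
  shows "real (card (quadrature_nodes q w T)) \<le> (T / w + 1) * real (card {x. poly (legendre_poly q) x = 0})"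
proof -
  let ?r = "card {x. poly (legendre_poly q) x = 0}"
  have fin: "finite {x. poly (legendre_poly q) x = 0}"
    by (rule poly_roots_finite[OF legendre_poly_nonzero])
  have "card (quadrature_nodes q w T) \<le> (\<Sum>k<nat \<lceil>T / w\<rceil>. ?r)"
    unfolding quadrature_nodes_def
    by (rule order.trans[OF card_UN_le[OF finite_lessThan] sum_mono]) (intro card_image_le fin)
  hence "real (card (quadrature_nodes q w T)) \<le> real (nat \<lceil>T / w\<rceil>) * real ?r"
    by (metis of_nat_le_iff of_nat_mult sum_constant card_lessThan of_nat_id)
  also have "real (nat \<lceil>T / w\<rceil>) \<le> T / w + 1"
    using assms by (simp add: of_nat_nat)
  finally show ?thesis by (simp add: mult_right_mono)
qed

text \<open>A root in the open interval gives a node strictly inside each panel, and the panels do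
  not overlap.\<close>

lemma card_quadrature_nodes_ge:
  assumes "q \<ge> 1" "w > 0" "T > 0"
  shows "T / w \<le> real (card (quadrature_nodes q w T))"
proof -
  obtain x where x: "- 1 < x" "x < 1" "poly (legendre_poly q) x = 0"
    using legendre_poly_root_exists[OF assms(1)] .
  define node where "node = (\<lambda>k. panel_end w T k + (panel_end w T (Suc k) - panel_end w T k) * (1 + x) / 2)"
  have node: "panel_end w T k < node k" "node k < panel_end w T (Suc k)" if k: "k < nat \<lceil>T / w\<rceil>" for k
  proof -
    have "real k < T / w" using k by linarith
    hence "w * real k < T" using assms by (simp add: field_simps)
    hence len: "panel_end w T (Suc k) - panel_end w T k > 0"
      using assms by (auto simp: panel_end_def min_def algebra_simps)
    have "(panel_end w T (Suc k) - panel_end w T k) * ((1 + x) / 2) > 0" using len x by simp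
    moreover have "(panel_end w T (Suc k) - panel_end w T k) * ((1 + x) / 2)
        < (panel_end w T (Suc k) - panel_end w T k) * 1"
      using len x by (intro mult_strict_left_mono) auto
    ultimately show "panel_end w T k < node k" "node k < panel_end w T (Suc k)" by (simp_all add: node_def)
  qed
  have mono: "panel_end w T i \<le> panel_end w T j" if "i \<le> j" for i j
    using that assms unfolding panel_end_def by (intro min.mono mult_left_mono) auto
  have "strict_mono_on {..<nat \<lceil>T / w\<rceil>} node"
  proof (rule strict_mono_onI)
    fix i j assume "i \<in> {..<nat \<lceil>T / w\<rceil>}" "j \<in> {..<nat \<lceil>T / w\<rceil>}" "i < j"
    thus "node i < node j" using node[of i] node[of j] mono[of "Suc i" j] by simp
  qed
  hence "card (node ` {..<nat \<lceil>T / w\<rceil>}) = nat \<lceil>T / w\<rceil>"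
    by (simp add: card_image strict_mono_on_imp_inj_on)
  moreover have "node ` {..<nat \<lceil>T / w\<rceil>} \<subseteq> quadrature_nodes q w T"
    using x unfolding quadrature_nodes_def node_def by blast
  ultimately have "nat \<lceil>T / w\<rceil> \<le> card (quadrature_nodes q w T)"
    using card_mono[OF finite_quadrature_nodes] by metis
  thus ?thesis by linarith
qed

section \<open>The cost of a one-stroke certificate\<close>

lemma T1_doubly_exponential_bounds:
  "\<forall>\<^sub>F L in at_top. 2 * pi * exp (3 * exp L) \<le> T1 L \<and> T1 L \<le> 2 * pi * exp (5 * exp L)"
proof -
  have "\<forall>\<^sub>F L in at_top. 3 < comb_mass L / exp L" "\<forall>\<^sub>F L in at_top. comb_mass L / exp L < 5"
    using comb_mass_asymptotics by (auto intro: order_tendstoD)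
  thus ?thesis
    by eventually_elim (auto simp: T1_def field_simps)
qed

text \<open>Constant factors and the factor \<open>L\<close> are absorbed by changing the multiple of \<open>e\<^sup>L\<close> in
  the exponent.\<close>

lemma grows_doubly_exponentially_sandwich:
  assumes c: "c1 > 0" "c2 > 0"
    and bounds: "\<forall>\<^sub>F L in at_top. c1 * T1 L \<le> f L \<and> f L \<le> c2 * (L * T1 L)"
  shows "grows_doubly_exponentially f"
  unfolding grows_doubly_exponentially_def
proof (intro exI conjI)
  have "\<forall>\<^sub>F L in at_top. exp (exp L) \<le> c1 * (2 * pi * exp (3 * exp L))"
    using c pi_gt_zero by real_asymp
  moreover have "\<forall>\<^sub>F L in at_top. c2 * (L * (2 * pi * exp (5 * exp L))) \<le> exp (6 * exp L)"
    using c pi_gt_zero by real_asymp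
  ultimately show "\<forall>\<^sub>F L in at_top. exp (1 * exp (1 * L)) \<le> f L \<and> f L \<le> exp (6 * exp (1 * L))"
    using bounds T1_doubly_exponential_bounds eventually_gt_at_top[of 0]
  proof eventually_elim
    case (elim L)
    have "c1 * (2 * pi * exp (3 * exp L)) \<le> c1 * T1 L" "c2 * (L * T1 L)
        \<le> c2 * (L * (2 * pi * exp (5 * exp L)))"
      using elim c by (auto intro!: mult_left_mono)
    with elim show ?case by simp
  qed
qed auto

lemma T1_pos [simp]: "T1 L > 0" by (simp add: T1_def)

lemma beta_star_pos_imp_T1_less:
  assumes "T > 0" "beta_star L T > 0" shows "T > T1 L"
proof -
  have "comb_mass L < ln (T / (2 * pi))"
    using assms by (auto simp: beta_star_def intro: less_trans[of _ "comb_mass L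
        + 1 / T"] dest: divide_pos_pos)
  hence "exp (comb_mass L) < T / (2 * pi)"
    using assms by (metis exp_less_cancel_iff exp_ln divide_pos_pos mult_pos_pos pi_gt_zero
        zero_less_numeral)
  thus ?thesis using pi_gt_zero by (simp add: T1_def field_simps)
qed

lemma prime_comb_le_mass: "prime_comb L t \<le> comb_mass L"
  unfolding prime_comb_def comb_mass_def
proof (rule sum_mono)
  fix n
  show "2 * mangoldt n / sqrt (real n) * cos (t * ln (real n)) \<le> 2 * mangoldt n / sqrt (real n)"
    by (intro mult_left_le cos_le_one) (simp add: mangoldt_nonneg)
qed

lemma prime_comb_0: "prime_comb L 0 = comb_mass L"
  by (simp add: prime_comb_def comb_mass_def)

text \<open>Admissibility already forces \<open>T > T\<^sub>1\<close>, and the hypothesis on \<open>T\<close> bounds it above by a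
  multiple of \<open>T\<^sub>1\<close>.\<close>

lemma one_stroke_costs:
  fixes T :: "real \<Rightarrow> real" and N :: "real \<Rightarrow> nat"
  assumes adm: "\<forall>\<^sub>F L in at_top. one_stroke_admissible L (T L) (N L)"
    and T: "T \<in> \<Theta>[at_top](T1)" and N: "(\<lambda>L. real (N L)) \<in> O[at_top](\<lambda>L. L * T L)"
    and qw: "q \<ge> 1" "w > 0"
  shows "(\<lambda>L. real (N L)) \<in> \<Theta>[at_top](\<lambda>L. L * T1 L)"
    "grows_doubly_exponentially (\<lambda>L. real (N L))"
    "grows_doubly_exponentially (\<lambda>L. real (card (quadrature_nodes q w (T L))))"
proof -
  obtain c where c: "c > 0" "\<forall>\<^sub>F L in at_top. norm (T L) \<le> c * norm (T1 L)"
    using bigthetaD1[OF T] by (elim landau_o.bigE)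
  obtain k where k: "k > 0" "\<forall>\<^sub>F L in at_top. norm (real (N L)) \<le> k * norm (L * T L)"
    using N by (elim landau_o.bigE)
  have T_bounds: "\<forall>\<^sub>F L in at_top. T1 L < T L \<and> T L \<le> c * T1 L"
    using adm c(2)
  proof eventually_elim
    case (elim L)
    hence "T1 L < T L" by (intro beta_star_pos_imp_T1_less) (auto simp: one_stroke_admissible_def)
    thus ?case using elim less_imp_le[OF T1_pos[of L]] by simp
  qed
  have N_bounds: "\<forall>\<^sub>F L in at_top. exp 1 / 4 * (L * T1 L) \<le> real (N L) \<and> real (N L) \<le> k * c * (L * T1 L)"
    using adm k(2) T_bounds eventually_gt_at_top[of 0]
  proof eventually_elim
    case (elim L)
    have "T L > 0" using elim T1_pos[of L] by linarith
    have "exp 1 / 4 * (L * T1 L) \<le> exp 1 / 4 * (L * T L)"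
      using elim by (intro mult_left_mono) auto
    also have "\<dots> \<le> real (N L)" using elim by (simp add: one_stroke_admissible_def)
    finally have lower: "exp 1 / 4 * (L * T1 L) \<le> real (N L)" .
    have "real (N L) \<le> k * (L * T L)" using elim \<open>T L > 0\<close> by simp
    also have "\<dots> \<le> k * (L * (c * T1 L))" using elim k(1) by (intro mult_left_mono) auto
    finally show ?case using lower by (simp add: mult_ac)
  qed
  show "(\<lambda>L. real (N L)) \<in> \<Theta>[at_top](\<lambda>L. L * T1 L)"
  proof (rule bigthetaI)
    have "\<forall>\<^sub>F L in at_top. norm (real (N L)) \<le> k * c * norm (L * T1 L)"
      using N_bounds eventually_gt_at_top[of 0] by eventually_elim (auto simp: abs_mult abs_of_pos)
    thus "(\<lambda>L. real (N L)) \<in> O[at_top](\<lambda>L. L * T1 L)" by (rule bigoI)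
    have "\<forall>\<^sub>F L in at_top. norm (real (N L)) \<ge> exp 1 / 4 * norm (L * T1 L)"
      using N_bounds eventually_gt_at_top[of 0] by eventually_elim (auto simp: abs_mult abs_of_pos)
    thus "(\<lambda>L. real (N L)) \<in> \<Omega>[at_top](\<lambda>L. L * T1 L)" by (rule landau_omega.bigI[rotated]) simp
  qed
  show "grows_doubly_exponentially (\<lambda>L. real (N L))"
  proof (rule grows_doubly_exponentially_sandwich)
    show "\<forall>\<^sub>F L in at_top. exp 1 / 4 * T1 L \<le> real (N L) \<and> real (N L) \<le> k * c * (L * T1 L)"
      using N_bounds eventually_ge_at_top[of 1]
    proof eventually_elim
      case (elim L)
      have "T1 L \<le> L * T1 L" using elim by simp
      hence "exp 1 / 4 * T1 L \<le> exp 1 / 4 * (L * T1 L)" by (intro mult_left_mono) auto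
      with elim show ?case by linarith
    qed
  qed (use c k in auto)
  define r where "r = real (card {x. poly (legendre_poly q) x = 0})"
  show "grows_doubly_exponentially (\<lambda>L. real (card (quadrature_nodes q w (T L))))"
  proof (rule grows_doubly_exponentially_sandwich)
    show "\<forall>\<^sub>F L in at_top. 1 / w * T1 L \<le> real (card (quadrature_nodes q w (T L)))
        \<and> real (card (quadrature_nodes q w (T L))) \<le> (c / w + 1) * (r + 1) * (L * T1 L)"
      using T_bounds T1_doubly_exponential_bounds eventually_ge_at_top[of 1]
    proof eventually_elim
      case (elim L)
      have T0: "T L > 0" using elim T1_pos[of L] by linarith
      have "1 / w * T1 L \<le> T L / w" using elim qw by (simp add: divide_right_mono)
      also have "\<dots> \<le> real (card (quadrature_nodes q w (T L)))"
        by (rule card_quadrature_nodes_ge) (use qw T0 in auto)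
      finally have lower: "1 / w * T1 L \<le> real (card (quadrature_nodes q w (T L)))" .
      have "1 * 1 \<le> 2 * pi * exp (3 * exp L)" using pi_gt3 by (intro mult_mono) auto
      hence T1_ge: "1 \<le> T1 L" using elim by linarith
      have "real (card (quadrature_nodes q w (T L))) \<le> (T L / w + 1) * r"
        unfolding r_def by (rule card_quadrature_nodes_le) (use qw T0 in auto)
      also have "\<dots> \<le> (c * T1 L / w + T1 L) * (r + 1)"
        using elim T1_ge qw by (intro mult_mono add_mono divide_right_mono) (auto simp: r_def)
      also have "\<dots> = (c / w + 1) * (r + 1) * (1 * T1 L)" by (simp add: algebra_simps)
      also have "\<dots> \<le> (c / w + 1) * (r + 1) * (L * T1 L)"
        using elim c qw T1_ge by (intro mult_left_mono mult_right_mono) (auto simp: r_def)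
      finally show ?case using lower by simp
    qed
    have "c / w + 1 > 0" "r + 1 > 0" using c qw by (simp_all add: r_def add_pos_pos)
    thus "(c / w + 1) * (r + 1) > 0" by simp
  qed (use qw in simp)
qed

theorem theorem1p4:
  shows
    "(\<forall>L T :: real. L > 0 \<longrightarrow> T > 0 \<longrightarrow> beta_star L T > 0 \<longrightarrow> T > T1 L)
     \<and> (\<exists>\<epsilon> \<in> o[at_top](\<lambda>_. 1 :: real). \<forall>L > 0. comb_mass L = (4 + \<epsilon> L) * exp L)
     \<and> (\<forall>(T :: real \<Rightarrow> real) (N :: real \<Rightarrow> nat) (q :: nat) (w :: real).
          (\<forall>\<^sub>F L in at_top. one_stroke_admissible L (T L) (N L)) \<longrightarrow>
          T \<in> \<Theta>[at_top](T1) \<longrightarrow>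
          (\<lambda>L. real (N L)) \<in> O[at_top](\<lambda>L. L * T L) \<longrightarrow>
          q \<ge> 1 \<longrightarrow> w > 0 \<longrightarrow>
          (\<lambda>L. real (dim_row (one_stroke_matrix L (T L) (N L)))) \<in> \<Theta>[at_top](\<lambda>L. L * T1 L)
          \<and> grows_doubly_exponentially (\<lambda>L. real (dim_row (one_stroke_matrix L (T L) (N L))))
          \<and> grows_doubly_exponentially (\<lambda>L. real (card (quadrature_nodes q w (T L)))))
     \<and> (\<forall>L > 0. bdd_above (range (prime_comb L)) \<and> (SUP t. prime_comb L t) = comb_mass L
          \<and> (\<forall>C. (\<forall>t. prime_comb L t \<le> C) \<longrightarrow> 2 * pi * exp C \<ge> T1 L))"
proof (intro conjI)
  show "\<forall>L T :: real. L > 0 \<longrightarrow> T > 0 \<longrightarrow> beta_star L T > 0 \<longrightarrow> T > T1 L"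
    using beta_star_pos_imp_T1_less by blast
  show "\<exists>\<epsilon> \<in> o[at_top](\<lambda>_. 1 :: real). \<forall>L > 0. comb_mass L = (4 + \<epsilon> L) * exp L"
  proof (intro bexI allI impI)
    show "(\<lambda>L. comb_mass L / exp L - 4) \<in> o[at_top](\<lambda>_. 1)"
      using comb_mass_asymptotics by (intro smalloI_tendsto) (auto simp: LIM_zero)
  qed (simp add: field_simps)
  show "\<forall>(T :: real \<Rightarrow> real) (N :: real \<Rightarrow> nat) (q :: nat) (w :: real).
          (\<forall>\<^sub>F L in at_top. one_stroke_admissible L (T L) (N L)) \<longrightarrow>
          T \<in> \<Theta>[at_top](T1) \<longrightarrow>
          (\<lambda>L. real (N L)) \<in> O[at_top](\<lambda>L. L * T L) \<longrightarrow>
          q \<ge> 1 \<longrightarrow> w > 0 \<longrightarrow>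
          (\<lambda>L. real (dim_row (one_stroke_matrix L (T L) (N L)))) \<in> \<Theta>[at_top](\<lambda>L. L * T1 L)
          \<and> grows_doubly_exponentially (\<lambda>L. real (dim_row (one_stroke_matrix L (T L) (N L))))
          \<and> grows_doubly_exponentially (\<lambda>L. real (card (quadrature_nodes q w (T L))))"
    unfolding one_stroke_matrix_def dim_row_mat(1) using one_stroke_costs by blast
  show "\<forall>L > 0. bdd_above (range (prime_comb L)) \<and> (SUP t. prime_comb L t) = comb_mass L
          \<and> (\<forall>C. (\<forall>t. prime_comb L t \<le> C) \<longrightarrow> 2 * pi * exp C \<ge> T1 L)"
  proof (intro allI impI conjI)
    fix L :: real
    show "bdd_above (range (prime_comb L))" using prime_comb_le_mass by (auto intro!: bdd_aboveI)
    show "(SUP t. prime_comb L t) = comb_mass L"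
      using prime_comb_le_mass[of L] prime_comb_0[of L]
      by (intro cSup_eq_maximum) (auto intro: rev_image_eqI[of 0])
    fix C assume "\<forall>t. prime_comb L t \<le> C"
    hence "comb_mass L \<le> C" using prime_comb_0 by metis
    thus "2 * pi * exp C \<ge> T1 L" by (simp add: T1_def)
  qed
qed

end
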